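(* Let $H,V,V',\gamma,A,a,f,F,\phi$ be as in the context. Assume that there exist $\alpha\in[0,1)$, $K>0$ and $t_0\ge0$ such that $\gamma(t)\ge\frac{K}{(1+t)^{\alpha}}$ for every $t\ge0$ and $\gamma'(t)\le-\alpha\frac{\gamma(t)}{1+t}$ for almost every $t\ge t_0$. Let $u$ be a solution to the equation $$\frac{d^2u}{dt^2}(t)+\gamma(t)\frac{du}{dt}(t)+Au(t)+f(u(t))=0,\qquad t\ge 0.$$ Then $u(t)$ converges weakly in $V$ as $t\to+\infty$ toward some $u_\infty\in\arg\min\phi$. Moreover, for every $\bar\alpha<\alpha$, $$\frac12\left|\frac{du}{dt}(t)\right|^2+\phi(u(t))-\min\phi=o\!\left(\frac1{t^{1+\bar\alpha}}\right)\quad\text{as }t\to+\infty.$$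
   Context: $H$ is a real Hilbert space with inner product $\langle\cdot,\cdot\rangle$ and norm $|\cdot|$. $V$ is a real Hilbert space with norm $\|\cdot\|_V$ such that $V\hookrightarrow H\hookrightarrow V'$ with continuous and dense injections, where $V'$ is the dual space of $V$ (so $H$ is identified with its own dual); $\langle\cdot,\cdot\rangle_{V',V}$ denotes the duality pairing. $\gamma:\mathbb{R}^+\to\mathbb{R}^+$ (with $\mathbb{R}^+=[0,+\infty)$) is a decreasing function belonging to $W^{1,1}_{loc}(\mathbb{R}^+;\mathbb{R}^+)$. $A:V\to V'$ is a linear continuous operator such that the bilinear form $a:V\times V\to\mathbb{R}$, $a(u,v)=\langle Au,v\rangle_{V',V}$, is symmetric, positive ($a(v,v)\ge0$ for all $v\in V$), and satisfies: there exist $\lambda\ge0$ and $\mu>0$ such that $a(v,v)+\lambda|v|^2\ge\mu\|v\|_V^2$ for all $v\in V$. $f:V\to V'$ is a continuous function deriving from a convex potential: there is a $C^1$ convex function $F:V\to\mathbb{R}$ with $F'(u)(v)=\langle f(u),v\rangle_{V',V}$ for all $u,v\in V$. $\phi:V\to\mathbb{R}$ is defined by $\phi(v)=\frac12a(v,v)+F(v)$. It is assumed that $\phi$ is bounded from below and that the set $\arg\min\phi=\{v\in V:\phi(v)=\min\phi\}$ is nonempty. A solution of the equation is a function $u:\mathbb{R}^+\to H$ belonging to $W^{1,1}_{loc}(\mathbb{R}^+,V)\cap W^{2,1}_{loc}(\mathbb{R}^+,H)$ and satisfying the equation for almost every $t\ge0$. *)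

theory Defs
  imports "HOL-Analysis.Analysis"
begin

text \<open>
  Real Hilbert spaces are types of sort \<open>{real_inner, banach}\<close>; no separability is assumed.
  The dual of \<open>'v\<close> is the type \<open>'v \<Rightarrow>\<^sub>L real\<close> with its operator norm, and the duality pairing
  is \<open>blinfun_apply\<close>.
\<close>

section \<open>The triple \<open>V \<hookrightarrow> H \<hookrightarrow> V'\<close>\<close>

text \<open>The injection of \<open>H\<close> into \<open>V'\<close> induced by \<open>J : V \<rightarrow> H\<close>, with \<open>H\<close> identified with its own dual:
  \<open>h\<close> acts on \<open>v\<close> as the inner product of \<open>h\<close> and \<open>J v\<close>.\<close>

definition pivot_embedding ::
    "('v::real_normed_vector \<Rightarrow>\<^sub>L 'h::real_inner) \<Rightarrow> 'h \<Rightarrow> ('v \<Rightarrow>\<^sub>L real)" where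
  "pivot_embedding J h = blinfun_inner_right h o\<^sub>L J"

lemma pivot_embedding_apply: "blinfun_apply (pivot_embedding J h) v = h \<bullet> blinfun_apply J v"
  by (simp add: pivot_embedding_def)

definition dense_embedding ::
    "('a::real_normed_vector \<Rightarrow> 'b::real_normed_vector) \<Rightarrow> bool" where
  "dense_embedding E \<longleftrightarrow> bounded_linear E \<and> inj E \<and> closure (range E) = UNIV"

definition gelfand_triple ::
    "('v::{real_inner,banach} \<Rightarrow>\<^sub>L 'h::{real_inner,banach}) \<Rightarrow> bool" where
  "gelfand_triple J \<longleftrightarrow>
     dense_embedding (blinfun_apply J) \<and> dense_embedding (pivot_embedding J)"

section \<open>Vector-valued Sobolev spaces on the half-line\<close>

text \<open>
  The library's \<open>has_bochner_integral\<close> is restricted to second-countable (separable) target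
  spaces. This is the same definition without that restriction. Approximability by simple
  functions makes the integrand essentially separably valued.
\<close>

definition has_bochner ::
    "'a measure \<Rightarrow> ('a \<Rightarrow> 'b) \<Rightarrow> 'b::real_normed_vector \<Rightarrow> bool" where
  "has_bochner M f x \<longleftrightarrow>
     f \<in> borel_measurable M \<and>
     (\<exists>s. (\<forall>i. Bochner_Integration.simple_bochner_integrable M (s i)) \<and>
          (\<lambda>i. \<integral>\<^sup>+y. ennreal (norm (f y - s i y)) \<partial>M) \<longlonglongrightarrow> 0 \<and>
          (\<lambda>i. Bochner_Integration.simple_bochner_integral M (s i)) \<longlonglongrightarrow> x)"

lemma has_bochner_iff_has_bochner_integral:
  fixes f :: "'a \<Rightarrow> 'b::{real_normed_vector, second_countable_topology}"
  shows "has_bochner M f x \<longleftrightarrow> has_bochner_integral M f x"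
  by (auto simp: has_bochner_def has_bochner_integral.simps)

text \<open>
  \<open>weak_deriv g g'\<close>: \<open>g'\<close> is Bochner integrable on every \<open>[0,T]\<close> and
  \<open>g(T) = g(0) + \<integral>\<^sub>0\<^sup>T g'\<close> for every \<open>T \<ge> 0\<close>, so \<open>g\<close> is the continuous representative of an element of
  \<open>W\<^sup>1\<^sup>,\<^sup>1\<^sub>l\<^sub>o\<^sub>c\<close> with weak derivative \<open>g'\<close> (determined up to null sets).
  Values at negative arguments are irrelevant.
\<close>

definition weak_deriv :: "(real \<Rightarrow> 'b::banach) \<Rightarrow> (real \<Rightarrow> 'b) \<Rightarrow> bool" where
  "weak_deriv g g' \<longleftrightarrow> (\<forall>T\<ge>0. has_bochner (lebesgue_on {0..T}) g' (g T - g 0))"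

definition W11_loc :: "(real \<Rightarrow> 'b::banach) \<Rightarrow> bool" where
  "W11_loc g \<longleftrightarrow> (\<exists>g'. weak_deriv g g')"

section \<open>Potential and equation\<close>

definition potential ::
    "('v::real_normed_vector \<Rightarrow>\<^sub>L ('v \<Rightarrow>\<^sub>L real)) \<Rightarrow> ('v \<Rightarrow> real) \<Rightarrow> 'v \<Rightarrow> real" where
  "potential A F v = (1/2) * blinfun_apply (blinfun_apply A v) v + F v"

definition argmin :: "('a \<Rightarrow> real) \<Rightarrow> 'a set" where
  "argmin p = {v. is_arg_min p (\<lambda>_. True) v}"

definition weakly_converges ::
    "('a \<Rightarrow> 'b::real_normed_vector) \<Rightarrow> 'b \<Rightarrow> 'a filter \<Rightarrow> bool" where
  "weakly_converges u l G \<longleftrightarrow>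
     (\<forall>p :: 'b \<Rightarrow>\<^sub>L real. ((\<lambda>t. blinfun_apply p (u t)) \<longlongrightarrow> blinfun_apply p l) G)"

text \<open>
  The trajectory is given by its \<open>V\<close>-valued continuous representative \<open>u\<close>; as an \<open>H\<close>-valued
  function it is \<open>J \<circ> u\<close>. The functions \<open>v\<close> and \<open>w\<close> are its first and second weak time
  derivatives in \<open>H\<close>, so their existence is membership in \<open>W\<^sup>2\<^sup>,\<^sup>1\<^sub>l\<^sub>o\<^sub>c\<close>. The equation is an equality
  in \<open>V'\<close>.
\<close>

definition is_solution ::
    "('v::{real_inner,banach} \<Rightarrow>\<^sub>L 'h::{real_inner,banach}) \<Rightarrow> (real \<Rightarrow> real) \<Rightarrow>
     ('v \<Rightarrow>\<^sub>L ('v \<Rightarrow>\<^sub>L real)) \<Rightarrow> ('v \<Rightarrow> ('v \<Rightarrow>\<^sub>L real)) \<Rightarrow> (real \<Rightarrow> 'v) \<Rightarrow> bool" where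
  "is_solution J \<gamma> A f u \<longleftrightarrow>
     W11_loc u \<and>
     (\<exists>v w. weak_deriv (\<lambda>t. blinfun_apply J (u t)) v \<and> weak_deriv v w \<and>
        (AE t in lebesgue_on {0..}.
           pivot_embedding J (w t) + \<gamma> t *\<^sub>R pivot_embedding J (v t)
             + blinfun_apply A (u t) + f (u t) = 0))"

end

theory Submission
  imports Defs
begin

text \<open>
  Fix a minimiser \<open>z\<close> of the potential. Everything is read off from three scalar functions of time: the
  energy \<open>E\<close> above the minimum, the squared speed \<open>n\<close>, and \<open>h\<close>, half the squared distance in \<open>H\<close> from the
  trajectory to \<open>z\<close>. The equation gives \<open>E' = - \<gamma> n\<close>, and pairing it with \<open>u - z\<close> gives, by convexity,
  \<open>h'' + \<gamma> h' \<le> 3/2 * n - E\<close>. Hence \<open>E\<close> is controlled by the dissipated quantity \<open>n\<close> up to total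
  derivatives, which is what makes decay possible.

  Weighting the energy identity with a power \<open>(1 + t) powr r\<close> and inserting the second inequality produces
  a Lyapunov function that is decreasing for large times as long as \<open>0 < r < 1 + \<alpha>\<close>
  (\<open>energy_and_distance_bounds\<close>). This yields \<open>E = O(t powr (- r))\<close> for all these \<open>r\<close>, which is the claimed rate, and
  almost boundedness of \<open>h\<close>. A second Lyapunov function built on \<open>(1 + t) powr \<alpha> * (h' + \<gamma> h)\<close> then shows that
  \<open>h\<close> converges (\<open>distance_convergent\<close>). The hypotheses on \<open>\<gamma>\<close> enter through \<open>(1 + t) powr \<alpha> * \<gamma> t\<close>, which decreases
  eventually and is bounded below by \<open>K\<close>.

  Thus the distance in \<open>H\<close> to each minimiser converges, the trajectory is bounded in \<open>V\<close> by coercivity, and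
  the potential tends to its minimum along it, so that weak cluster points are minimisers. These are the
  ingredients of Opial's lemma (\<open>weakly_converges_if_distances_converge\<close>). Its compactness part is replaced by
  the fact that decreasing sequences of nonempty bounded closed convex sets in a Hilbert space have a
  common point.

  The analytic difficulty is that \<open>E\<close> and \<open>h'\<close> are only absolutely continuous, with derivatives in possibly
  non-separable spaces. The calculus below therefore works with increments and integrals of pairings:
  \<open>weak_deriv_bilinear\<close> is the product rule, and \<open>weak_deriv_subgradient\<close> is the chain rule that gives the
  energy identity.
\<close>

section \<open>Bochner integrals seen through functionals\<close>

text \<open>
  In a non-separable space the difference of two measurable functions need not be measurable, so
  the norm of a difference is handled through the finitely many values of the simple function.
\<close>

lemma borel_measurable_norm_diff_simple_function:
  fixes f s :: "'a \<Rightarrow> 'b::real_normed_vector"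
  assumes f: "f \<in> borel_measurable M" and s: "simple_function M s"
  shows "(\<lambda>x. norm (f x - s x)) \<in> borel_measurable M"
proof (rule measurable_compose_countable'[where f = "\<lambda>c x. norm (f x - c)" and g = s
      and I = "s ` space M"])
  fix c
  show "(\<lambda>x. norm (f x - c)) \<in> borel_measurable M"
    by (rule measurable_compose[OF f]) (intro borel_measurable_continuous_onI continuous_intros)
next
  show "s \<in> measurable M (count_space (s ` space M))"
    using s by (subst measurable_count_space_eq2) (auto simp: simple_function_def)
  show "countable (s ` space M)"
    using s by (auto simp: simple_function_def intro: countable_finite)
qed

lemma has_bochner_functional:
  fixes p :: "'b::real_normed_vector \<Rightarrow> real"
  assumes f: "has_bochner M f x" and p: "bounded_linear p"
  shows "has_bochner_integral M (\<lambda>t. p (f t)) (p x)"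
proof -
  interpret p: bounded_linear p by fact
  from f obtain s where fm: "f \<in> borel_measurable M"
    and s: "\<And>i. Bochner_Integration.simple_bochner_integrable M (s i)"
    and lim: "(\<lambda>i. \<integral>\<^sup>+y. ennreal (norm (f y - s i y)) \<partial>M) \<longlonglongrightarrow> 0"
    and x: "(\<lambda>i. Bochner_Integration.simple_bochner_integral M (s i)) \<longlonglongrightarrow> x"
    unfolding has_bochner_def by blast
  obtain B where B: "B \<ge> 0" "\<And>y. norm (p y) \<le> norm y * B"
    using p.nonneg_bounded by blast
  have sf: "simple_function M (s i)" for i
    using s[of i] by (auto simp: simple_bochner_integrable.simps)
  note meas = borel_measurable_norm_diff_simple_function[OF fm sf]
  show ?thesis
  proof (rule has_bochner_integral.intros[where s = "\<lambda>i t. p (s i t)"])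
    show "(\<lambda>t. p (f t)) \<in> borel_measurable M"
      by (rule measurable_compose[OF fm])
        (intro borel_measurable_continuous_onI p.continuous_on continuous_on_id)
    show "Bochner_Integration.simple_bochner_integrable M (\<lambda>t. p (s i t))" for i
      by (rule simple_bochner_integrable_compose2[of "\<lambda>x y. p x", OF _ s s]) (rule p.zero)
    show "(\<lambda>i. Bochner_Integration.simple_bochner_integral M (\<lambda>t. p (s i t))) \<longlonglongrightarrow> p x"
      using s p.tendsto[OF x] by (simp add: simple_bochner_integral_linear p.linear_axioms)
    show "(\<lambda>i. \<integral>\<^sup>+ t. ennreal (norm (p (f t) - p (s i t))) \<partial>M) \<longlonglongrightarrow> 0"
    proof (rule tendsto_sandwich[OF _ _ tendsto_const])
      have "(\<integral>\<^sup>+ t. ennreal (norm (p (f t) - p (s i t))) \<partial>M)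
            \<le> (\<integral>\<^sup>+ t. ennreal B * ennreal (norm (f t - s i t)) \<partial>M)" for i
        by (intro nn_integral_mono)
          (metis B p.diff ennreal_leI ennreal_mult' mult.commute)
      also have "(\<integral>\<^sup>+ t. ennreal B * ennreal (norm (f t - s i t)) \<partial>M)
            = ennreal B * (\<integral>\<^sup>+ t. ennreal (norm (f t - s i t)) \<partial>M)" for i
        using meas by (intro nn_integral_cmult) auto
      finally show "\<forall>\<^sub>F i in sequentially. (\<integral>\<^sup>+ t. ennreal (norm (p (f t) - p (s i t))) \<partial>M)
            \<le> ennreal B * (\<integral>\<^sup>+ t. ennreal (norm (f t - s i t)) \<partial>M)"
        by simp
      show "(\<lambda>i. ennreal B * (\<integral>\<^sup>+ t. ennreal (norm (f t - s i t)) \<partial>M)) \<longlonglongrightarrow> 0"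
        using ennreal_tendsto_cmult[OF _ lim, of "ennreal B"] by simp
    qed auto
  qed
qed

text \<open>
  One of the approximating simple functions is within distance \<open>1\<close> in \<open>L\<^sup>1\<close>, and simple functions
  have integrable norm.
\<close>

lemma has_bochner_integrable_norm:
  assumes f: "has_bochner M f x"
  shows "integrable M (\<lambda>t. norm (f t))"
proof -
  from f obtain s where fm: "f \<in> borel_measurable M"
    and s: "\<And>i. Bochner_Integration.simple_bochner_integrable M (s i)"
    and lim: "(\<lambda>i. \<integral>\<^sup>+y. ennreal (norm (f y - s i y)) \<partial>M) \<longlonglongrightarrow> 0"
    unfolding has_bochner_def by blast
  have "\<forall>\<^sub>F i in sequentially. (\<integral>\<^sup>+y. ennreal (norm (f y - s i y)) \<partial>M) < 1"
    using order_tendstoD(2)[OF lim] by auto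
  then obtain i where i: "(\<integral>\<^sup>+y. ennreal (norm (f y - s i y)) \<partial>M) < 1"
    by (auto dest: eventually_happens)
  have sf: "simple_function M (s i)"
    using s[of i] by (auto simp: simple_bochner_integrable.simps)
  have ns: "Bochner_Integration.simple_bochner_integrable M (\<lambda>t. norm (s i t))"
    by (rule simple_bochner_integrable_compose2[of "\<lambda>x y. norm x", OF _ s s]) simp
  have nsm: "(\<lambda>t. norm (s i t)) \<in> borel_measurable M"
    using sf by (intro borel_measurable_simple_function) (rule simple_function_compose1)
  note meas = borel_measurable_norm_diff_simple_function[OF fm sf]
  have "(\<integral>\<^sup>+t. ennreal (norm (f t)) \<partial>M)
      \<le> (\<integral>\<^sup>+t. ennreal (norm (f t - s i t)) + ennreal (norm (s i t)) \<partial>M)"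
    by (intro nn_integral_mono)
      (metis ennreal_leI ennreal_plus norm_ge_zero norm_triangle_sub add.commute)
  also have "\<dots> = (\<integral>\<^sup>+t. ennreal (norm (f t - s i t)) \<partial>M) + (\<integral>\<^sup>+t. ennreal (norm (s i t)) \<partial>M)"
    using meas nsm by (intro nn_integral_add) auto
  also have "(\<integral>\<^sup>+t. ennreal (norm (s i t)) \<partial>M) =
      ennreal (Bochner_Integration.simple_bochner_integral M (\<lambda>t. norm (s i t)))"
    by (rule simple_bochner_integral_eq_nn_integral[OF ns, symmetric]) simp
  also have "(\<integral>\<^sup>+t. ennreal (norm (f t - s i t)) \<partial>M) + \<dots> < \<infinity>"
    using i by (metis ennreal_add_less_top ennreal_less_top ennreal_one_less_top infinity_ennreal_def order.strict_trans)
  finally show ?thesis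
    by (intro integrableI_bounded measurable_compose[OF fm])
      (auto intro!: borel_measurable_continuous_onI continuous_intros)
qed

section \<open>Calculus of weak derivatives\<close>

lemma weak_deriv_real_iff:
  fixes g g' :: "real \<Rightarrow> real"
  shows "weak_deriv g g' \<longleftrightarrow> (\<forall>T\<ge>0. integrable (lebesgue_on {0..T}) g' \<and>
           integral\<^sup>L (lebesgue_on {0..T}) g' = g T - g 0)"
  unfolding weak_deriv_def has_bochner_iff_has_bochner_integral has_bochner_integral_iff ..

lemma integrable_lebesgue_on_subset:
  fixes f :: "'a::euclidean_space \<Rightarrow> real"
  assumes "integrable (lebesgue_on S) f" "T \<subseteq> S" "T \<in> sets lebesgue" "S \<in> sets lebesgue"
  shows "integrable (lebesgue_on T) f"
  using set_integrable_subset[of lebesgue S f T] assms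
  by (simp add: integrable_restrict_space set_integrable_def)

lemma integral_lebesgue_on_Icc_diff:
  fixes f :: "real \<Rightarrow> real"
  assumes "integrable (lebesgue_on {c..b}) f" "c \<le> a" "a \<le> b"
  shows "integral\<^sup>L (lebesgue_on {a..b}) f
    = integral\<^sup>L (lebesgue_on {c..b}) f - integral\<^sup>L (lebesgue_on {c..a}) f"
proof -
  have i: "integrable (lebesgue_on {x..y}) f" if "c \<le> x" "y \<le> b" for x y
    by (rule integrable_lebesgue_on_subset[OF assms(1)]) (use that in auto)
  have eq: "integral\<^sup>L (lebesgue_on {x..y}) f = integral {x..y} f" if "c \<le> x" "y \<le> b" for x y
    by (rule lebesgue_integral_eq_integral[OF i[OF that]]) auto
  have "f integrable_on {c..b}"
    by (rule integrable_on_lebesgue_on[OF assms(1)]) auto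
  then have "integral {c..a} f + integral {a..b} f = integral {c..b} f"
    using assms by (intro Henstock_Kurzweil_Integration.integral_combine) auto
  then show ?thesis using assms eq by simp
qed

lemma weak_deriv_norm_integrable:
  assumes "weak_deriv g g'" "0 \<le> a"
  shows "integrable (lebesgue_on {a..b}) (\<lambda>t. norm (g' t))"
proof -
  have "has_bochner (lebesgue_on {0..max 0 b}) g' (g (max 0 b) - g 0)"
    using assms(1) by (simp add: weak_deriv_def)
  then have "integrable (lebesgue_on {0..max 0 b}) (\<lambda>t. norm (g' t))"
    by (rule has_bochner_integrable_norm)
  then show ?thesis
    by (rule integrable_lebesgue_on_subset) (use assms in auto)
qed

lemma weak_deriv_functional:
  fixes p :: "'b::banach \<Rightarrow> real"
  assumes g: "weak_deriv g g'" and p: "bounded_linear p"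
  shows "weak_deriv (\<lambda>t. p (g t)) (\<lambda>t. p (g' t))"
  unfolding weak_deriv_def has_bochner_iff_has_bochner_integral
proof (intro allI impI)
  fix T :: real assume "T \<ge> 0"
  then have "has_bochner (lebesgue_on {0..T}) g' (g T - g 0)"
    using g by (simp add: weak_deriv_def)
  from has_bochner_functional[OF this p]
  show "has_bochner_integral (lebesgue_on {0..T}) (\<lambda>t. p (g' t)) (p (g T) - p (g 0))"
    by (simp add: linear_diff[OF bounded_linear.linear[OF p]])
qed

lemma weak_deriv_integral:
  fixes g g' :: "real \<Rightarrow> real"
  assumes "weak_deriv g g'" "0 \<le> a" "a \<le> b"
  shows "integrable (lebesgue_on {a..b}) g'"
    and "integral\<^sup>L (lebesgue_on {a..b}) g' = g b - g a"
proof -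
  have 1: "integrable (lebesgue_on {0..b}) g'"
    using assms by (auto simp: weak_deriv_real_iff)
  show "integrable (lebesgue_on {a..b}) g'"
    by (rule integrable_lebesgue_on_subset[OF 1]) (use assms in auto)
  show "integral\<^sup>L (lebesgue_on {a..b}) g' = g b - g a"
    using integral_lebesgue_on_Icc_diff[OF 1, of a] assms by (simp add: weak_deriv_real_iff)
qed

lemma AE_lebesgue_on_subset:
  assumes "AE t in lebesgue_on S. P t" "T \<subseteq> S" "S \<in> sets lebesgue" "T \<in> sets lebesgue"
  shows "AE t in lebesgue_on T. P t"
proof -
  have "AE t in lebesgue. t \<in> S \<longrightarrow> P t"
    using assms(1,3) by (subst (asm) AE_restrict_space_iff) auto
  then have "AE t in lebesgue. t \<in> T \<longrightarrow> P t"
    by (rule eventually_mono) (use assms(2) in auto)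
  then show ?thesis
    using assms(4) by (subst AE_restrict_space_iff) auto
qed

text \<open>
  Every Lyapunov argument below ends with this lemma: the sign of the derivative is only known
  almost everywhere, and absolute continuity makes that enough for monotonicity.
\<close>

lemma weak_deriv_nonpos_imp_le:
  fixes g g' :: "real \<Rightarrow> real"
  assumes g: "weak_deriv g g'" and le: "AE t in lebesgue_on {T0..}. g' t \<le> 0"
    and "0 \<le> T0" "T0 \<le> a" "a \<le> b"
  shows "g b \<le> g a"
proof -
  have "AE t in lebesgue_on {a..b}. g' t \<le> 0"
    by (rule AE_lebesgue_on_subset[OF le]) (use assms in auto)
  then have "AE t in lebesgue_on {a..b}. 0 \<le> - g' t"
    by (auto elim!: eventually_mono)
  from integral_nonneg_AE[OF this] have "0 \<le> integral\<^sup>L (lebesgue_on {a..b}) (\<lambda>t. - g' t)" .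
  also have "\<dots> = - (g b - g a)"
    using weak_deriv_integral[OF g, of a b] assms by simp
  finally show ?thesis by simp
qed

lemma continuous_on_atLeast_0I:
  fixes f :: "real \<Rightarrow> 'a::metric_space"
  assumes "\<And>T. 0 \<le> T \<Longrightarrow> continuous_on {0..T} f"
  shows "continuous_on {0..} f"
  unfolding continuous_on_iff
proof (intro ballI allI impI)
  fix x e :: real assume x: "x \<in> {0..}" and e: "0 < e"
  then have "\<exists>d>0. \<forall>y\<in>{0..x+1}. dist y x < d \<longrightarrow> dist (f y) (f x) < e"
    using assms[of "x + 1", unfolded continuous_on_iff, THEN bspec, of x] by simp
  then obtain d where d: "d > 0"
    "\<And>y. y \<in> {0..x+1} \<Longrightarrow> dist y x < d \<Longrightarrow> dist (f y) (f x) < e"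
    by blast
  show "\<exists>d>0. \<forall>y\<in>{0..}. dist y x < d \<longrightarrow> dist (f y) (f x) < e"
    by (rule exI[of _ "min d 1"]) (use d x in \<open>auto simp: dist_real_def\<close>)
qed

lemma weak_deriv_real_continuous:
  fixes g g' :: "real \<Rightarrow> real"
  assumes g: "weak_deriv g g'"
  shows "continuous_on {0..} g"
proof (rule continuous_on_atLeast_0I)
  fix T :: real assume T: "0 \<le> T"
  have i: "integrable (lebesgue_on {0..x}) g'" if "0 \<le> x" for x
    using weak_deriv_integral(1)[OF g _ that] by simp
  have "integral {0..x} g' = g x - g 0" if "0 \<le> x" for x
    using weak_deriv_integral(2)[OF g _ that] lebesgue_integral_eq_integral[OF i[OF that]] by simp
  then have eq: "g x = g 0 + integral {0..x} g'" if "x \<in> {0..T}" for x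
    using that by simp
  have "continuous_on {0..T} (\<lambda>x. g 0 + integral {0..x} g')"
    by (intro continuous_intros indefinite_integral_continuous_1 integrable_on_lebesgue_on i T) simp
  then show "continuous_on {0..T} g"
    by (rule continuous_on_eq) (rule eq[symmetric])
qed

lemma weak_deriv_indefinite:
  fixes f :: "real \<Rightarrow> real"
  assumes "\<And>T. 0 \<le> T \<Longrightarrow> integrable (lebesgue_on {0..T}) f"
  shows "weak_deriv (\<lambda>t. integral\<^sup>L (lebesgue_on {0..t}) f) f"
proof -
  have "integral\<^sup>L (lebesgue_on {0..0}) f = 0"
    using integral_lebesgue_on_Icc_diff[of 0 0 f 0] assms[of 0] by simp
  then show ?thesis using assms by (simp add: weak_deriv_real_iff)
qed

text \<open>
  The triangle inequality for the Bochner integral, obtained without measurability issues by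
  testing the increment \<open>y\<close> of \<open>g\<close> against the functional \<open>y \<bullet> _\<close>.
\<close>

lemma weak_deriv_norm_diff_le:
  fixes g :: "real \<Rightarrow> 'b::{real_inner,banach}"
  assumes g: "weak_deriv g g'" and "0 \<le> a" "a \<le> b"
  shows "norm (g b - g a) \<le> integral\<^sup>L (lebesgue_on {a..b}) (\<lambda>t. norm (g' t))"
proof -
  define y where "y = g b - g a"
  note p = weak_deriv_functional[OF g bounded_linear_inner_right[of y]]
  have "norm y * norm y = y \<bullet> g b - y \<bullet> g a"
    unfolding inner_diff_right[symmetric] y_def[symmetric]
    by (simp add: dot_square_norm power2_eq_square)
  also have "\<dots> = integral\<^sup>L (lebesgue_on {a..b}) (\<lambda>t. y \<bullet> g' t)"
    using weak_deriv_integral(2)[OF p] assms by simp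
  also have "\<dots> \<le> integral\<^sup>L (lebesgue_on {a..b}) (\<lambda>t. norm y * norm (g' t))"
    using weak_deriv_integral(1)[OF p] weak_deriv_norm_integrable[OF g] assms
    by (intro integral_mono) (auto simp: norm_cauchy_schwarz)
  also have "\<dots> = norm y * integral\<^sup>L (lebesgue_on {a..b}) (\<lambda>t. norm (g' t))"
    by simp
  finally have *: "norm y * norm y \<le> norm y * integral\<^sup>L (lebesgue_on {a..b}) (\<lambda>t. norm (g' t))" .
  show ?thesis
  proof (cases "y = 0")
    case True
    then show ?thesis unfolding y_def[symmetric] by simp
  next
    case False
    then show ?thesis using * unfolding y_def[symmetric] by simp
  qed
qed

lemma weak_deriv_continuous:
  fixes g :: "real \<Rightarrow> 'b::{real_inner,banach}"
  assumes g: "weak_deriv g g'"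
  shows "continuous_on {0..} g"
proof -
  define L where "L t = integral\<^sup>L (lebesgue_on {0..t}) (\<lambda>t. norm (g' t))" for t
  have L: "weak_deriv L (\<lambda>t. norm (g' t))"
    unfolding L_def by (intro weak_deriv_indefinite weak_deriv_norm_integrable[OF g]) simp
  have le: "dist (g x) (g y) \<le> dist (L x) (L y)" if "x \<ge> 0" "y \<ge> 0" for x y
  proof (cases "x \<le> y")
    case True
    have "norm (g y - g x) \<le> L y - L x"
      using weak_deriv_norm_diff_le[OF g, of x y] weak_deriv_integral(2)[OF L, of x y] that True by simp
    then show ?thesis by (simp add: dist_norm dist_real_def norm_minus_commute)
  next
    case False
    have "norm (g x - g y) \<le> L x - L y"
      using weak_deriv_norm_diff_le[OF g, of y x] weak_deriv_integral(2)[OF L, of y x] that False by simp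
    then show ?thesis by (simp add: dist_norm dist_real_def)
  qed
  show ?thesis
    unfolding continuous_on_iff
  proof (intro ballI allI impI)
    fix x e :: real assume x: "x \<in> {0..}" and e: "0 < e"
    then have "\<exists>d>0. \<forall>y\<in>{0..}. dist y x < d \<longrightarrow> dist (L y) (L x) < e"
      using weak_deriv_real_continuous[OF L, unfolded continuous_on_iff, THEN bspec, of x] by simp
    then obtain d where d: "d > 0" "\<And>y. y \<in> {0..} \<Longrightarrow> dist y x < d \<Longrightarrow> dist (L y) (L x) < e"
      by blast
    have "dist (g y) (g x) < e" if "y \<in> {0..}" "dist y x < d" for y
      using le[of y x] d(2)[OF that] that x by auto
    with d(1) show "\<exists>d>0. \<forall>y\<in>{0..}. dist y x < d \<longrightarrow> dist (g y) (g x) < e"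
      by blast
  qed
qed

lemma weak_deriv_measurable:
  assumes "weak_deriv g g'" "0 \<le> a"
  shows "g' \<in> borel_measurable (lebesgue_on {a..b})"
proof -
  have "has_bochner (lebesgue_on {0..max 0 b}) g' (g (max 0 b) - g 0)"
    using assms(1) by (simp add: weak_deriv_def)
  then have "g' \<in> borel_measurable (lebesgue_on {0..max 0 b})"
    unfolding has_bochner_def by (rule conjunct1)
  then show ?thesis
    by (rule measurable_restrict_mono) (use assms(2) in auto)
qed

text \<open>
  The delicate point is measurability: pairs of measurable functions into non-separable spaces
  need not be measurable. Freezing \<open>g\<close> on a grid of mesh \<open>1/(n+1)\<close> leaves countably many functionals
  of \<open>f\<close>, each measurable, and continuity of \<open>g\<close> lets the mesh tend to \<open>0\<close>.
\<close>

lemma integrable_bilinear_continuous: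
  fixes B :: "'a::real_normed_vector \<Rightarrow> 'b::real_normed_vector \<Rightarrow> real"
    and a b :: real
  assumes B: "bounded_bilinear B"
    and f: "f \<in> borel_measurable (lebesgue_on {a..b})"
    and nf: "integrable (lebesgue_on {a..b}) (\<lambda>t. norm (f t))"
    and g: "continuous_on {a..b} g"
  shows "integrable (lebesgue_on {a..b}) (\<lambda>t. B (f t) (g t))"
proof -
  interpret B: bounded_bilinear B by fact
  \<comment> \<open>The last grid point before \<open>t\<close>.\<close>
  define d where "d n t = a + of_int \<lfloor>real (Suc n) * (t - a)\<rfloor> / real (Suc n)" for n and t :: real
  have d: "a \<le> d n t" "d n t \<le> t" "t \<le> d n t + inverse (real (Suc n))" if "a \<le> t" for n t
  proof -
    have "0 \<le> real (Suc n) * (t - a)" using that by simp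
    then have "0 \<le> \<lfloor>real (Suc n) * (t - a)\<rfloor>" by linarith
    then show "a \<le> d n t" unfolding d_def by (simp del: of_nat_Suc)
    have "real_of_int \<lfloor>real (Suc n) * (t - a)\<rfloor> \<le> real (Suc n) * (t - a)" by linarith
    then show "d n t \<le> t" unfolding d_def by (simp add: field_simps del: of_nat_Suc)
    have "real (Suc n) * (t - a) \<le> real_of_int \<lfloor>real (Suc n) * (t - a)\<rfloor> + 1" by linarith
    then show "t \<le> d n t + inverse (real (Suc n))"
      unfolding d_def by (simp add: field_simps del: of_nat_Suc)
  qed
  have dt: "(\<lambda>n. d n t) \<longlonglongrightarrow> t" if "a \<le> t" for t
  proof (rule tendsto_sandwich[OF _ _ _ tendsto_const])
    show "(\<lambda>n. t - inverse (real (Suc n))) \<longlonglongrightarrow> t"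
      using tendsto_diff[OF tendsto_const LIMSEQ_inverse_real_of_nat, of t] by simp
    show "\<forall>\<^sub>F n in sequentially. t - inverse (real (Suc n)) \<le> d n t"
      using d(3)[OF that] by (auto simp: algebra_simps simp del: of_nat_Suc)
  qed (use d(2)[OF that] in auto)
  have meas: "(\<lambda>t. B (f t) (g t)) \<in> borel_measurable (lebesgue_on {a..b})"
  proof (rule borel_measurable_LIMSEQ_real)
    fix t assume "t \<in> space (lebesgue_on {a..b})"
    then have t: "t \<in> {a..b}" by simp
    have "(\<lambda>n. g (d n t)) \<longlonglongrightarrow> g t"
      by (rule continuous_on_tendsto_compose[OF g dt])
        (use t d in \<open>auto intro!: always_eventually order_trans[OF d(2)]\<close>)
    then show "(\<lambda>n. B (f t) (g (d n t))) \<longlonglongrightarrow> B (f t) (g t)"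
      by (rule B.tendsto[OF tendsto_const])
  next
    fix n
    show "(\<lambda>t. B (f t) (g (d n t))) \<in> borel_measurable (lebesgue_on {a..b})"
      unfolding d_def
    proof (rule measurable_compose_countable[where f = "\<lambda>i t. B (f t) (g (a + of_int i / real (Suc n)))"
          and g = "\<lambda>t. \<lfloor>real (Suc n) * (t - a)\<rfloor>"])
      fix i :: int
      show "(\<lambda>t. B (f t) (g (a + of_int i / real (Suc n)))) \<in> borel_measurable (lebesgue_on {a..b})"
        by (rule measurable_compose[OF f])
          (intro borel_measurable_continuous_onI B.continuous_on continuous_intros)
      have "(\<lambda>t::real. \<lfloor>real (Suc n) * (t - a)\<rfloor>) \<in> borel \<rightarrow>\<^sub>M count_space UNIV"
        by measurable
      then have "(\<lambda>t::real. \<lfloor>real (Suc n) * (t - a)\<rfloor>) \<in> lebesgue \<rightarrow>\<^sub>M count_space UNIV"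
        by (metis measurable_completion measurable_lborel2)
      then show "(\<lambda>t. \<lfloor>real (Suc n) * (t - a)\<rfloor>) \<in> lebesgue_on {a..b} \<rightarrow>\<^sub>M count_space UNIV"
        by (rule measurable_restrict_space1)
    qed
  qed
  obtain K where K: "K > 0" "\<And>x y. norm (B x y) \<le> norm x * norm y * K"
    using B.pos_bounded by blast
  obtain C where C: "\<And>t. t \<in> {a..b} \<Longrightarrow> norm (g t) \<le> C"
    using compact_imp_bounded[OF compact_continuous_image[OF g compact_Icc]]
    unfolding bounded_iff by blast
  show ?thesis
  proof (rule Bochner_Integration.integrable_bound[OF _ meas])
    show "integrable (lebesgue_on {a..b}) (\<lambda>t. C * K * norm (f t))"
      using nf by simp
    show "AE t in lebesgue_on {a..b}. norm (B (f t) (g t)) \<le> norm (C * K * norm (f t))"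
    proof (rule AE_I2)
      fix t assume "t \<in> space (lebesgue_on {a..b})"
      then have t: "t \<in> {a..b}" by simp
      have "norm (B (f t) (g t)) \<le> norm (f t) * norm (g t) * K" by (rule K)
      also have "\<dots> \<le> norm (f t) * C * K"
        using C[OF t] K(1) by (intro mult_right_mono mult_left_mono) auto
      also have "\<dots> \<le> norm (C * K * norm (f t))" by (simp add: mult.commute mult.left_commute)
      finally show "norm (B (f t) (g t)) \<le> norm (C * K * norm (f t))" .
    qed
  qed
qed

text \<open>
  A Riemann-Stieltjes argument: increments that are, at small scales, negligible with respect to the
  increments of a fixed function \<open>L\<close> add up to nothing over a fine partition. In this way chain and
  product rules follow from estimates on increments, without differentiability almost everywhere.
\<close>

lemma increments_dominated_imp_eq:
  fixes G L :: "real \<Rightarrow> real"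
  assumes "a \<le> b"
    and small: "\<And>\<epsilon>. \<epsilon> > 0 \<Longrightarrow> \<exists>\<delta>>0. \<forall>s t. a \<le> s \<longrightarrow> s \<le> t \<longrightarrow> t \<le> b \<longrightarrow> t - s < \<delta>
                 \<longrightarrow> \<bar>G t - G s\<bar> \<le> \<epsilon> * (L t - L s)"
  shows "G b = G a"
proof -
  have bound: "\<bar>G b - G a\<bar> \<le> \<epsilon> * (L b - L a)" if eps: "\<epsilon> > 0" for \<epsilon>
  proof -
    obtain \<delta> where \<delta>: "\<delta> > 0" "\<And>s t. a \<le> s \<Longrightarrow> s \<le> t \<Longrightarrow> t \<le> b \<Longrightarrow> t - s < \<delta>
                 \<Longrightarrow> \<bar>G t - G s\<bar> \<le> \<epsilon> * (L t - L s)"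
      using small[OF eps] by blast
    obtain N where N: "(b - a) / \<delta> < real N" using reals_Archimedean2 by blast
    with \<delta> \<open>a \<le> b\<close> have N0: "N > 0"
      by (metis diff_ge_0_iff_ge divide_nonneg_pos gr0I not_le of_nat_0)
    define x where "x i = a + real i * ((b - a) / real N)" for i
    have x0: "x 0 = a" and xN: "x N = b" using N0 by (auto simp: x_def)
    have step: "x (Suc i) - x i = (b - a) / real N" for i
      proof -
      have "a + (1 + r) * q - (a + r * q) = q" for r q :: real by (simp add: distrib_right)
      then show ?thesis unfolding x_def of_nat_Suc by blast
    qed
    have lt: "(b - a) / real N < \<delta>" using N N0 \<delta>(1) by (simp add: field_simps)
    have mono: "x i \<le> x j" if "i \<le> j" for i j
      unfolding x_def using that \<open>a \<le> b\<close> by (intro add_left_mono mult_right_mono) auto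
    have "\<bar>G b - G a\<bar> = \<bar>\<Sum>i<N. G (x (Suc i)) - G (x i)\<bar>"
      using sum_lessThan_telescope[of "\<lambda>i. G (x i)" N] by (simp add: x0 xN)
    also have "\<dots> \<le> (\<Sum>i<N. \<bar>G (x (Suc i)) - G (x i)\<bar>)" by (rule sum_abs)
    also have "\<dots> \<le> (\<Sum>i<N. \<epsilon> * (L (x (Suc i)) - L (x i)))"
    proof (rule sum_mono)
      fix i assume "i \<in> {..<N}"
      then show "\<bar>G (x (Suc i)) - G (x i)\<bar> \<le> \<epsilon> * (L (x (Suc i)) - L (x i))"
        using mono[of 0 i] mono[of "Suc i" N] mono[of i "Suc i"] step[of i] lt
        by (intro \<delta>) (auto simp: x0 xN)
    qed
    also have "\<dots> = \<epsilon> * (L b - L a)"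
      using sum_lessThan_telescope[of "\<lambda>i. L (x i)" N]
      by (simp add: x0 xN flip: sum_distrib_left)
    finally show ?thesis .
  qed
  show ?thesis
  proof (rule ccontr)
    assume "G b \<noteq> G a"
    then have D: "\<bar>G b - G a\<bar> > 0" by simp
    have M: "\<bar>G b - G a\<bar> \<le> L b - L a" using bound[of 1] by simp
    \<comment> \<open>This \<open>\<epsilon>\<close> makes the bound half of the left-hand side.\<close>
    then have "\<bar>G b - G a\<bar> \<le> \<bar>G b - G a\<bar> / (2 * (L b - L a)) * (L b - L a)"
      using D by (intro bound) auto
    also have "\<dots> = \<bar>G b - G a\<bar> / 2" using D M by (auto simp: field_simps)
    finally show False using D by simp
  qed
qed

text \<open>
  The product rule. Let \<open>G\<close> be the product minus the integral of its expected derivative. Over a short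
  interval \<open>[s,t]\<close> the increment of \<open>G\<close> is the integral of \<open>B (f') (g s - g) + B (f t - f) (g')\<close>;
  by uniform continuity this is small compared with the integral of the norms of \<open>f'\<close> and \<open>g'\<close>.
  Hence \<open>G\<close> is constant.
\<close>

lemma weak_deriv_bilinear:
  fixes B :: "'a::{real_inner,banach} \<Rightarrow> 'b::{real_inner,banach} \<Rightarrow> real"
  assumes B: "bounded_bilinear B" and f: "weak_deriv f f'" and g: "weak_deriv g g'"
  shows "weak_deriv (\<lambda>t. B (f t) (g t)) (\<lambda>t. B (f' t) (g t) + B (f t) (g' t))"
proof -
  interpret B: bounded_bilinear B by fact
  note cf = weak_deriv_continuous[OF f] and cg = weak_deriv_continuous[OF g]
  have i1: "integrable (lebesgue_on {a..b}) (\<lambda>t. B (f' t) (x t))"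
    if "0 \<le> a" "continuous_on {a..b} x" for a b x
    using integrable_bilinear_continuous[OF B weak_deriv_measurable[OF f] weak_deriv_norm_integrable[OF f]] that
    by simp
  have i2: "integrable (lebesgue_on {a..b}) (\<lambda>t. B (x t) (g' t))"
    if "0 \<le> a" "continuous_on {a..b} x" for a b x
    using integrable_bilinear_continuous[OF B.flip weak_deriv_measurable[OF g] weak_deriv_norm_integrable[OF g]] that
    by simp
  have i: "integrable (lebesgue_on {a..b}) (\<lambda>t. B (f' t) (g t) + B (f t) (g' t))" if "0 \<le> a" for a b
    by (rule Bochner_Integration.integrable_add; rule i1 i2)
      (use that in \<open>auto intro: continuous_on_subset[OF cf] continuous_on_subset[OF cg]\<close>)
  define I where "I t = integral\<^sup>L (lebesgue_on {0..t}) (\<lambda>t. B (f' t) (g t) + B (f t) (g' t))" for t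
  have I: "weak_deriv I (\<lambda>t. B (f' t) (g t) + B (f t) (g' t))"
    unfolding I_def by (intro weak_deriv_indefinite i) simp
  have inorm: "integrable (lebesgue_on {a..b}) (\<lambda>t. norm (f' t) + norm (g' t))" if "0 \<le> a" for a b
    by (intro Bochner_Integration.integrable_add weak_deriv_norm_integrable[OF f that]
        weak_deriv_norm_integrable[OF g that])
  define L where "L t = integral\<^sup>L (lebesgue_on {0..t}) (\<lambda>t. norm (f' t) + norm (g' t))" for t
  have L: "weak_deriv L (\<lambda>t. norm (f' t) + norm (g' t))"
    unfolding L_def by (intro weak_deriv_indefinite inorm) simp
  obtain K where K: "K > 0" "\<And>x y. norm (B x y) \<le> norm x * norm y * K"
    using B.pos_bounded by blast
  define G where "G t = B (f t) (g t) - I t" for t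
  have G: "G T = G 0" if T: "0 \<le> T" for T
  proof (rule increments_dominated_imp_eq[OF T, where L = L])
    fix \<epsilon> :: real assume eps: "\<epsilon> > 0"
    have "uniformly_continuous_on {0..T} f" "uniformly_continuous_on {0..T} g"
      by (auto intro!: compact_uniformly_continuous continuous_on_subset[OF cf] continuous_on_subset[OF cg])
    moreover have "\<epsilon> / K > 0" using eps K by simp
    ultimately obtain d1 d2 where d: "d1 > 0" "d2 > 0"
      "\<And>s t. s \<in> {0..T} \<Longrightarrow> t \<in> {0..T} \<Longrightarrow> dist t s < d1 \<Longrightarrow> dist (f t) (f s) < \<epsilon> / K"
      "\<And>s t. s \<in> {0..T} \<Longrightarrow> t \<in> {0..T} \<Longrightarrow> dist t s < d2 \<Longrightarrow> dist (g t) (g s) < \<epsilon> / K"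
      unfolding uniformly_continuous_on_def by metis
    show "\<exists>\<delta>>0. \<forall>s t. 0 \<le> s \<longrightarrow> s \<le> t \<longrightarrow> t \<le> T \<longrightarrow> t - s < \<delta> \<longrightarrow> \<bar>G t - G s\<bar> \<le> \<epsilon> * (L t - L s)"
    proof (intro exI[of _ "min d1 d2"] conjI allI impI)
      show "min d1 d2 > 0" using d by simp
      fix s t assume st: "0 \<le> s" "s \<le> t" "t \<le> T" "t - s < min d1 d2"
      have j1: "integrable (lebesgue_on {s..t}) (\<lambda>r. B (f' r) (g r))"
        and j2: "integrable (lebesgue_on {s..t}) (\<lambda>r. B (f r) (g' r))"
        and j3: "integrable (lebesgue_on {s..t}) (\<lambda>r. B (f' r) (g s))"
        and j4: "integrable (lebesgue_on {s..t}) (\<lambda>r. B (f t) (g' r))"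
        using st by (auto intro!: i1 i2 continuous_on_subset[OF cf] continuous_on_subset[OF cg] continuous_on_const)
      have "B (f t) (g t) - B (f s) (g s) = (B (f t) (g s) - B (f s) (g s)) + (B (f t) (g t) - B (f t) (g s))"
        by simp
      also have "B (f t) (g s) - B (f s) (g s) = integral\<^sup>L (lebesgue_on {s..t}) (\<lambda>r. B (f' r) (g s))"
        using weak_deriv_integral(2)[OF weak_deriv_functional[OF f B.bounded_linear_left[of "g s"]]] st by simp
      also have "B (f t) (g t) - B (f t) (g s) = integral\<^sup>L (lebesgue_on {s..t}) (\<lambda>r. B (f t) (g' r))"
        using weak_deriv_integral(2)[OF weak_deriv_functional[OF g B.bounded_linear_right[of "f t"]]] st by simp
      finally have "G t - G s = integral\<^sup>L (lebesgue_on {s..t}) (\<lambda>r. B (f' r) (g s)) +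
          integral\<^sup>L (lebesgue_on {s..t}) (\<lambda>r. B (f t) (g' r)) -
          integral\<^sup>L (lebesgue_on {s..t}) (\<lambda>r. B (f' r) (g r) + B (f r) (g' r))"
        using weak_deriv_integral(2)[OF I, of s t] st by (simp add: G_def)
      also have "\<dots> = integral\<^sup>L (lebesgue_on {s..t}) (\<lambda>r. B (f' r) (g s - g r) + B (f t - f r) (g' r))"
        using j1 j2 j3 j4 by (simp add: B.diff_left B.diff_right)
      also have "\<bar>\<dots>\<bar> \<le> integral\<^sup>L (lebesgue_on {s..t}) (\<lambda>r. norm (B (f' r) (g s - g r) + B (f t - f r) (g' r)))"
        unfolding real_norm_def by (rule integral_abs_bound)
      also have "\<dots> \<le> integral\<^sup>L (lebesgue_on {s..t}) (\<lambda>r. \<epsilon> * (norm (f' r) + norm (g' r)))"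
      proof (rule integral_mono)
        show "integrable (lebesgue_on {s..t}) (\<lambda>r. norm (B (f' r) (g s - g r) + B (f t - f r) (g' r)))"
          using j1 j2 j3 j4 by (simp add: B.diff_left B.diff_right)
        show "integrable (lebesgue_on {s..t}) (\<lambda>r. \<epsilon> * (norm (f' r) + norm (g' r)))"
          using inorm st by simp
        fix r assume "r \<in> space (lebesgue_on {s..t})"
        then have r: "s \<le> r" "r \<le> t" by auto
        have "norm (g s - g r) \<le> \<epsilon> / K" "norm (f t - f r) \<le> \<epsilon> / K"
          using d(3)[of r t] d(4)[of r s] r st by (auto simp: dist_norm)
        then have "norm (f' r) * norm (g s - g r) * K \<le> norm (f' r) * (\<epsilon> / K) * K"
            "norm (f t - f r) * norm (g' r) * K \<le> (\<epsilon> / K) * norm (g' r) * K"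
          using K(1) by (intro mult_right_mono mult_left_mono; simp)+
        with K(2)[of "f' r" "g s - g r"] K(2)[of "f t - f r" "g' r"]
        have "norm (B (f' r) (g s - g r)) \<le> norm (f' r) * (\<epsilon> / K) * K"
            "norm (B (f t - f r) (g' r)) \<le> (\<epsilon> / K) * norm (g' r) * K"
          by linarith+
        then show "norm (B (f' r) (g s - g r) + B (f t - f r) (g' r)) \<le> \<epsilon> * (norm (f' r) + norm (g' r))"
          using K(1) norm_triangle_ineq[of "B (f' r) (g s - g r)" "B (f t - f r) (g' r)"]
          by (simp add: algebra_simps)
      qed
      also have "\<dots> = \<epsilon> * (L t - L s)"
        using weak_deriv_integral(2)[OF L, of s t] st by simp
      finally show "\<bar>G t - G s\<bar> \<le> \<epsilon> * (L t - L s)" .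
    qed
  qed
  show ?thesis
    unfolding weak_deriv_real_iff
  proof (intro allI impI conjI i)
    fix T :: real assume "0 \<le> T"
    from G[OF this] weak_deriv_integral(2)[OF I, of 0 T] \<open>0 \<le> T\<close>
    show "integral\<^sup>L (lebesgue_on {0..T}) (\<lambda>t. B (f' t) (g t) + B (f t) (g' t)) = B (f T) (g T) - B (f 0) (g 0)"
      by (simp add: G_def)
  qed simp
qed

lemma weak_deriv_mult:
  fixes f g :: "real \<Rightarrow> real"
  assumes "weak_deriv f f'" "weak_deriv g g'"
  shows "weak_deriv (\<lambda>t. f t * g t) (\<lambda>t. f' t * g t + f t * g' t)"
  by (rule weak_deriv_bilinear[OF bounded_bilinear_mult assms])

lemma weak_deriv_add:
  fixes f g :: "real \<Rightarrow> real"
  assumes "weak_deriv f f'" "weak_deriv g g'"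
  shows "weak_deriv (\<lambda>t. f t + g t) (\<lambda>t. f' t + g' t)"
  using assms by (auto simp: weak_deriv_real_iff)

lemma weak_deriv_diff_const:
  "weak_deriv g g' \<Longrightarrow> weak_deriv (\<lambda>t. g t - c) g'"
  by (simp add: weak_deriv_def)

lemma weak_deriv_C1:
  fixes g g' :: "real \<Rightarrow> real"
  assumes d: "\<And>t. 0 \<le> t \<Longrightarrow> (g has_real_derivative g' t) (at t)" and c: "continuous_on {0..} g'"
  shows "weak_deriv g g'"
  unfolding weak_deriv_real_iff
proof (intro allI impI conjI)
  fix T :: real assume T: "0 \<le> T"
  show i: "integrable (lebesgue_on {0..T}) g'"
    by (intro continuous_imp_integrable_real continuous_on_subset[OF c]) auto
  have "(g' has_integral (g T - g 0)) {0..T}"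
    using T d by (intro fundamental_theorem_of_calculus)
      (auto simp: has_real_derivative_iff_has_vector_derivative intro: has_vector_derivative_at_within)
  then show "integral\<^sup>L (lebesgue_on {0..T}) g' = g T - g 0"
    using lebesgue_integral_eq_integral[OF i] by (simp add: integral_unique)
qed

lemma weak_deriv_const: "weak_deriv (\<lambda>t. c::real) (\<lambda>t. 0)"
  by (rule weak_deriv_C1) auto

lemma weak_deriv_shift: "weak_deriv (\<lambda>t::real. 1 + t) (\<lambda>t. 1)"
  by (rule weak_deriv_C1) (auto intro!: derivative_eq_intros)

lemma weak_deriv_powr: "weak_deriv (\<lambda>t::real. (1 + t) powr r) (\<lambda>t. r * (1 + t) powr (r - 1))"
  by (rule weak_deriv_C1) (auto intro!: derivative_eq_intros continuous_intros)

text \<open>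
  Testing against the vector \<open>z = X b - X 0 - \<integral> v\<close> identifies the weak primitive with the classical one.
\<close>

lemma weak_deriv_has_vector_derivative:
  fixes X :: "real \<Rightarrow> 'h::{real_inner,banach}"
  assumes X: "weak_deriv X v" and v: "continuous_on {0..} v" and t: "0 \<le> t"
  shows "(X has_vector_derivative v t) (at t within {0..})"
proof -
  have eq: "X 0 + integral {0..b} v = X b" if "0 \<le> b" for b
  proof -
    define z where "z = X b - X 0 - integral {0..b} v"
    have vi: "v integrable_on {0..b}"
      by (intro integrable_continuous_real continuous_on_subset[OF v]) auto
    have cv: "continuous_on {0..b} (\<lambda>s. z \<bullet> v s)"
      by (intro continuous_intros continuous_on_subset[OF v]) auto
    note p = weak_deriv_functional[OF X bounded_linear_inner_right[of z]]
    have "z \<bullet> X b - z \<bullet> X 0 = integral\<^sup>L (lebesgue_on {0..b}) (\<lambda>s. z \<bullet> v s)"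
      using weak_deriv_integral(2)[OF p _ that] by simp
    also have "\<dots> = integral {0..b} (\<lambda>s. z \<bullet> v s)"
      by (intro lebesgue_integral_eq_integral continuous_imp_integrable_real cv) auto
    also have "\<dots> = z \<bullet> integral {0..b} v"
      using has_integral_linear[OF integrable_integral[OF vi] bounded_linear_inner_right[of z]]
      by (simp add: o_def integral_unique)
    finally have "z \<bullet> (X b - X 0 - integral {0..b} v) = 0"
      by (simp add: inner_diff_right)
    then have "z = 0" unfolding z_def[symmetric] by simp
    then show ?thesis unfolding z_def by (simp add: algebra_simps)
  qed
  have "((\<lambda>s. X 0 + integral {0..s} v) has_vector_derivative v t) (at t within {0..t+1})"
    using integral_has_vector_derivative[OF continuous_on_subset[OF v], of 0 "t + 1" t] t
    by (auto intro!: derivative_eq_intros)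
  moreover have "at t within {0..t+1} = at t within {0..}"
    by (rule at_within_nhd[of _ "{..<t+1}"]) auto
  ultimately have "((\<lambda>s. X 0 + integral {0..s} v) has_vector_derivative v t) (at t within {0..})"
    by simp
  then show ?thesis
    by (rule has_vector_derivative_transform[rotated 2]) (use t eq in auto)
qed

text \<open>
  A chain rule for a convex function along a trajectory, when its gradient \<open>y\<close> is a vector of \<open>'h\<close> at
  almost every time while the trajectory \<open>X\<close> is continuously differentiable in \<open>'h\<close>. The subgradient
  inequality gives \<open>D (t + e) - D t \<ge> y t \<bullet> (X (t + e) - X t)\<close>. Divide by \<open>e\<close> and integrate over \<open>[0,T]\<close>:
  the left side tends to \<open>D T - D 0\<close> because it is a difference quotient of a primitive of \<open>D\<close>, the
  right side tends to \<open>\<integral> y \<bullet> v\<close> by dominated convergence. Positive and negative steps \<open>e\<close> yield the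
  two opposite inequalities. Differentiability of \<open>D\<close> is never assumed; it is the conclusion.
\<close>

lemma weak_deriv_subgradient:
  fixes D N :: "real \<Rightarrow> real" and X v y :: "real \<Rightarrow> 'h::{real_inner,banach}"
  assumes D: "continuous_on {0..} D"
    and X: "weak_deriv X v" and v: "continuous_on {0..} v"
    and y: "\<And>T Z. 0 \<le> T \<Longrightarrow> continuous_on {0..T} Z \<Longrightarrow> integrable (lebesgue_on {0..T}) (\<lambda>t. y t \<bullet> Z t)"
    and N: "\<And>T. 0 \<le> T \<Longrightarrow> integrable (lebesgue_on {0..T}) N" "\<And>t. 0 \<le> t \<Longrightarrow> norm (y t) \<le> N t"
    and sub: "AE t in lebesgue_on {0..}. \<forall>s\<ge>0. y t \<bullet> (X s - X t) \<le> D s - D t"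
  shows "weak_deriv D (\<lambda>t. y t \<bullet> v t)"
proof -
  have iv: "integrable (lebesgue_on {0..T}) (\<lambda>t. y t \<bullet> v t)" if "0 \<le> T" for T
    by (rule y[OF that]) (auto intro: continuous_on_subset[OF v])
  note cX = weak_deriv_continuous[OF X]
  \<comment> \<open>Constant extension to negative times, so that negative steps make sense near \<open>0\<close>.\<close>
  define D' where "D' t = D (max 0 t)" for t
  define X' where "X' t = X (max 0 t)" for t
  have cD': "continuous_on S D'" for S
    unfolding D'_def
    by (rule continuous_on_compose2[OF D]) (auto intro!: continuous_intros)
  have cX': "continuous_on S X'" for S
    unfolding X'_def
    by (rule continuous_on_compose2[OF cX]) (auto intro!: continuous_intros)
  have main: "\<sigma> * integral\<^sup>L (lebesgue_on {0..T}) (\<lambda>t. y t \<bullet> v t) \<le> \<sigma> * (D T - D 0)"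
    if \<sigma>: "\<bar>\<sigma>\<bar> = 1" and T: "0 \<le> T" for \<sigma> T :: real
  proof -
    \<comment> \<open>\<open>\<sigma>\<close> is the sign of the time step.\<close>
    define e where "e n = \<sigma> / real (Suc n)" for n
    have e0: "e n \<noteq> 0" and e1: "\<bar>e n\<bar> \<le> 1" for n
      using \<sigma> by (auto simp: e_def abs_mult field_simps)
    have "(\<lambda>n. \<sigma> * inverse (real (Suc n))) \<longlonglongrightarrow> \<sigma> * 0"
      by (intro tendsto_mult tendsto_const LIMSEQ_inverse_real_of_nat)
    then have e: "e \<longlonglongrightarrow> 0" by (simp add: e_def[abs_def] divide_inverse)
    have eat: "filterlim e (at 0) sequentially"
      using e e0 by (simp add: filterlim_at)
    define f where "f n t = (y t \<bullet> (X' (t + e n) - X' t)) / e n" for n t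
    define q where "q n t = (D' (t + e n) - D' t) / e n" for n t
    have fi: "integrable (lebesgue_on {0..T}) (f n)" for n
      unfolding f_def
      by (intro integrable_divide_zero impI y T continuous_intros continuous_on_compose2[OF cX'[of UNIV]]) auto
    have qi: "integrable (lebesgue_on {0..T}) (q n)" for n
      unfolding q_def
      by (intro continuous_imp_integrable_real continuous_intros continuous_on_compose2[OF cD'[of UNIV]])
        (use e0 in auto)
    have le: "integral\<^sup>L (lebesgue_on {0..T}) (\<lambda>t. \<sigma> * f n t) \<le> integral\<^sup>L (lebesgue_on {0..T}) (\<lambda>t. \<sigma> * q n t)" for n
    proof (rule integral_mono_AE)
      have "AE t in lebesgue_on {0..T}. \<forall>s\<ge>0. y t \<bullet> (X s - X t) \<le> D s - D t"
        by (rule AE_lebesgue_on_subset[OF sub]) auto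
      moreover have "AE t in lebesgue_on {0..T}. t \<in> {0..T}"
        by (rule AE_I2) simp
      ultimately show "AE t in lebesgue_on {0..T}. \<sigma> * f n t \<le> \<sigma> * q n t"
      proof eventually_elim
        case (elim t)
        then have "y t \<bullet> (X' (t + e n) - X' t) \<le> D' (t + e n) - D' t"
          by (simp add: X'_def D'_def)
        moreover have "\<sigma> / e n \<ge> 0" by (simp add: e_def)
        ultimately have "\<sigma> / e n * (y t \<bullet> (X' (t + e n) - X' t)) \<le> \<sigma> / e n * (D' (t + e n) - D' t)"
          by (rule mult_left_mono)
        then show ?case by (simp add: f_def q_def)
      qed
    qed (use fi qi in auto)
    have limf: "(\<lambda>n. integral\<^sup>L (lebesgue_on {0..T}) (f n)) \<longlonglongrightarrow> integral\<^sup>L (lebesgue_on {0..T}) (\<lambda>t. y t \<bullet> v t)"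
    proof -
      have "bounded (v ` {0..T+1})"
        by (intro compact_imp_bounded compact_continuous_image continuous_on_subset[OF v]) auto
      then obtain C where C: "\<And>t. t \<in> {0..T+1} \<Longrightarrow> norm (v t) \<le> C"
        unfolding bounded_iff by blast
      have lip: "norm (X b - X a) \<le> C * \<bar>b - a\<bar>" if "a \<in> {0..T+1}" "b \<in> {0..T+1}" for a b
        unfolding real_norm_def[symmetric]
      proof (rule differentiable_bound[where S = "{0..T+1}" and f' = "\<lambda>x h. h *\<^sub>R v x"])
        fix x assume x: "x \<in> {0..T+1}"
        have "(X has_vector_derivative v x) (at x within {0..T+1})"
          by (rule has_vector_derivative_within_subset[OF weak_deriv_has_vector_derivative[OF X v]])
            (use x in auto)
        then show "(X has_derivative (\<lambda>h. h *\<^sub>R v x)) (at x within {0..T+1})"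
          by (simp add: has_vector_derivative_def)
        have "norm (v x) * \<bar>h\<bar> \<le> C * \<bar>h\<bar>" for h
          using C[OF x] by (simp add: mult_right_mono)
        then show "onorm (\<lambda>h. h *\<^sub>R v x) \<le> C"
          by (intro onorm_le) (simp add: mult.commute)
      qed (use that in auto)
      show ?thesis
      proof (rule integral_dominated_convergence[where w = "\<lambda>t. C * N t"])
        show "(\<lambda>t. y t \<bullet> v t) \<in> borel_measurable (lebesgue_on {0..T})"
          using iv[OF T] by auto
        show "f n \<in> borel_measurable (lebesgue_on {0..T})" for n
          using fi by auto
        show "integrable (lebesgue_on {0..T}) (\<lambda>t. C * N t)"
          using N(1)[OF T] by simp
        show "AE t in lebesgue_on {0..T}. norm (f n t) \<le> C * N t" for n
        proof (rule AE_I2)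
          fix t assume "t \<in> space (lebesgue_on {0..T})"
          then have t: "0 \<le> t" "t \<le> T" by auto
          have C0: "0 \<le> C" using C[of 0] T norm_ge_zero[of "v 0"] by (meson order_trans atLeastAtMost_iff add_nonneg_nonneg order_refl zero_le_one)
          have "norm (X' (t + e n) - X' t) \<le> C * \<bar>max 0 (t + e n) - t\<bar>"
            using lip[of t "max 0 (t + e n)"] t e1[of n] by (auto simp: X'_def)
          also have "\<dots> \<le> C * \<bar>e n\<bar>"
            using t C0 by (intro mult_left_mono) auto
          finally have "norm (X' (t + e n) - X' t) \<le> C * \<bar>e n\<bar>" .
          then have "norm (y t) * norm (X' (t + e n) - X' t) \<le> N t * (C * \<bar>e n\<bar>)"
            using N(2)[OF t(1)] C0 by (intro mult_mono) (auto intro: order_trans[OF norm_ge_zero])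
          then have "\<bar>y t \<bullet> (X' (t + e n) - X' t)\<bar> \<le> N t * (C * \<bar>e n\<bar>)"
            using Cauchy_Schwarz_ineq2 order_trans by blast
          then show "norm (f n t) \<le> C * N t"
            using e0[of n] by (simp add: f_def abs_divide divide_le_eq mult_ac)
        qed
        have "AE t in lebesgue. t \<noteq> (0::real)"
          by (rule AE_completion) (rule AE_lborel_singleton)
        then have "AE t in lebesgue. t \<in> {0..T} \<longrightarrow> t \<noteq> 0 \<and> t \<in> {0..T}"
          by (rule eventually_mono) auto
        then have "AE t in lebesgue_on {0..T}. t \<noteq> 0 \<and> t \<in> {0..T}"
          by (subst AE_restrict_space_iff) auto
        then show "AE t in lebesgue_on {0..T}. (\<lambda>n. f n t) \<longlonglongrightarrow> y t \<bullet> v t"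
        proof eventually_elim
          case (elim t)
          then have t: "t > 0" by auto
          have "(X has_vector_derivative v t) (at t within {0..})"
            by (rule weak_deriv_has_vector_derivative[OF X v]) (use t in auto)
          moreover have "at t within {0..} = at t"
            by (rule at_within_interior) (use t in simp)
          ultimately have "(X has_vector_derivative v t) (at t)"
            by simp
          then have "((\<lambda>s. y t \<bullet> X s) has_vector_derivative (y t \<bullet> v t)) (at t)"
            by (rule bounded_linear.has_vector_derivative[OF bounded_linear_inner_right])
          then have "((\<lambda>h. (y t \<bullet> X (t + h) - y t \<bullet> X t) / h) \<longlongrightarrow> y t \<bullet> v t) (at 0)"
            unfolding has_real_derivative_iff_has_vector_derivative[symmetric] DERIV_def by simp
          from filterlim_compose[OF this eat]
          have "(\<lambda>n. (y t \<bullet> X (t + e n) - y t \<bullet> X t) / e n) \<longlonglongrightarrow> y t \<bullet> v t" .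
          moreover have "\<forall>\<^sub>F n in sequentially. (y t \<bullet> X (t + e n) - y t \<bullet> X t) / e n = f n t"
          proof -
            have "\<forall>\<^sub>F n in sequentially. e n > - t"
              using order_tendstoD(1)[OF e, of "-t"] t by simp
            then show ?thesis
              by eventually_elim (use t in \<open>simp add: f_def X'_def inner_diff_right\<close>)
          qed
          ultimately show ?case by (rule Lim_transform_eventually)
        qed
      qed
    qed
    have limq: "(\<lambda>n. integral\<^sup>L (lebesgue_on {0..T}) (q n)) \<longlonglongrightarrow> D T - D 0"
    proof -
      \<comment> \<open>Starting at \<open>-2\<close> keeps every \<open>x + e n\<close>, \<open>x \<in> [0,T]\<close>, in the interior of the interval.\<close>
      define P where "P x = integral {-2..x} D'" for x
      have P: "(P has_real_derivative D' x) (at x)" if "-2 < x" "x < T + 2" for x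
      proof -
        have "(P has_vector_derivative D' x) (at x within {-2..T+2})"
          unfolding P_def by (rule integral_has_vector_derivative[OF cD']) (use that in auto)
        moreover have "at x within {-2..T+2} = at x"
          by (rule at_within_interior) (use that in simp)
        ultimately show ?thesis
          unfolding has_real_derivative_iff_has_vector_derivative by simp
      qed
      have int: "((\<lambda>t. D' (t + h)) has_integral (P (T + h) - P h)) {0..T}" if "\<bar>h\<bar> \<le> 1" for h
      proof -
        have "((\<lambda>t. D' (t + h)) has_integral (P (T + h) - P (0 + h))) {0..T}"
        proof (rule fundamental_theorem_of_calculus[OF T])
          fix t assume "t \<in> {0..T}"
          then have "(P has_real_derivative D' (t + h)) (at (t + h))"
            using that by (intro P) auto
          then have "((\<lambda>t. P (t + h)) has_real_derivative D' (t + h)) (at t)"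
            by (simp add: DERIV_shift)
          then show "((\<lambda>t. P (t + h)) has_vector_derivative D' (t + h)) (at t within {0..T})"
            unfolding has_real_derivative_iff_has_vector_derivative by (rule has_vector_derivative_at_within)
        qed
        then show ?thesis by simp
      qed
      have "integral\<^sup>L (lebesgue_on {0..T}) (q n) = ((P (T + e n) - P (e n)) - (P T - P 0)) / e n" for n
      proof -
        have "(q n has_integral ((P (T + e n) - P (e n)) - (P T - P 0)) / e n) {0..T}"
          unfolding q_def
          using has_integral_divide[OF has_integral_diff[OF int[OF e1[of n]] int[of 0]]] by simp
        then show ?thesis
          using lebesgue_integral_eq_integral[OF qi[of n]] by (simp add: integral_unique)
      qed
      moreover have "((\<lambda>h. P (T + h) - P h) has_real_derivative D' T - D' 0) (at 0)"
      proof (rule DERIV_diff)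
        show "((\<lambda>h. P (T + h)) has_real_derivative D' T) (at 0)"
          using DERIV_shift[of P "D' T" 0 T] P[of T] T by (simp add: add.commute)
        show "(P has_real_derivative D' 0) (at 0)" using P[of 0] T by simp
      qed
      then have "((\<lambda>h. ((P (T + h) - P h) - (P T - P 0)) / h) \<longlongrightarrow> D' T - D' 0) (at 0)"
        by (simp add: DERIV_def)
      note filterlim_compose[OF this eat]
      ultimately show ?thesis using T by (simp add: D'_def)
    qed
    have "\<sigma> * integral\<^sup>L (lebesgue_on {0..T}) (f n) \<le> \<sigma> * integral\<^sup>L (lebesgue_on {0..T}) (q n)" for n
      using le[of n] by simp
    then show ?thesis
      by (intro LIMSEQ_le[OF tendsto_mult_left[OF limf] tendsto_mult_left[OF limq]]) auto
  qed
  show ?thesis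
    unfolding weak_deriv_real_iff
  proof (intro allI impI conjI iv)
    fix T :: real assume T: "0 \<le> T"
    from main[of 1 T] main[of "-1" T] T
    show "integral\<^sup>L (lebesgue_on {0..T}) (\<lambda>t. y t \<bullet> v t) = D T - D 0" by simp
  qed
qed

section \<open>Decay for the damped scalar inequality\<close>

lemma decreasing_bdd_below_imp_convergent:
  fixes f :: "real \<Rightarrow> real"
  assumes mono: "\<And>s t. T \<le> s \<Longrightarrow> s \<le> t \<Longrightarrow> f t \<le> f s" and bound: "\<And>t. T \<le> t \<Longrightarrow> m \<le> f t"
  shows "\<exists>l\<ge>m. (f \<longlongrightarrow> l) at_top"
proof -
  define l where "l = Inf (f ` {T..})"
  have bdd: "bdd_below (f ` {T..})" using bound by (intro bdd_belowI2[of _ m]) auto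
  have "l \<ge> m" unfolding l_def by (rule cInf_greatest) (use bound in auto)
  moreover have "(f \<longlongrightarrow> l) at_top"
  proof (rule decreasing_tendsto)
    show "\<forall>\<^sub>F t in at_top. l \<le> f t"
      using eventually_ge_at_top[of T] by eventually_elim (auto simp: l_def intro!: cInf_lower bdd)
    fix x assume "l < x"
    then obtain s where s: "s \<ge> T" "f s < x"
      unfolding l_def using cInf_lessD[of "f ` {T..}" x] by auto
    show "\<forall>\<^sub>F t in at_top. f t < x"
      using eventually_ge_at_top[of s] by eventually_elim (use mono s in force)
  qed
  ultimately show ?thesis by blast
qed

text \<open>
  What the evolution equation says about scalars, once a minimiser \<open>z\<close> of the potential is chosen:
  \<open>E\<close> is the energy above the minimum, \<open>n\<close> the squared speed, \<open>h\<close> half the squared distance of the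
  trajectory to \<open>z\<close> in \<open>H\<close>, and \<open>k = h'\<close>. The inequality for \<open>k'\<close> is the convexity of the potential,
  \<open>k_le\<close> is the Cauchy-Schwarz inequality, and the two conditions on \<open>\<gamma>\<close> say that
  \<open>(1 + t) powr \<alpha> * \<gamma> t\<close> stays above \<open>K\<close> and decreases from time \<open>t0\<close> on.
\<close>

locale damped_inequality =
  fixes E h k k' n \<gamma> \<gamma>' :: "real \<Rightarrow> real" and \<alpha> K t0 :: real
  assumes alpha: "0 \<le> \<alpha>" "\<alpha> < 1" and K_pos: "0 < K" and t0: "0 \<le> t0"
    and E_deriv: "weak_deriv E (\<lambda>t. - (\<gamma> t * n t))"
    and h_deriv: "weak_deriv h k"
    and k_deriv: "weak_deriv k k'"
    and g_deriv: "weak_deriv \<gamma> \<gamma>'"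
    and n_nonneg: "\<And>t. 0 \<le> t \<Longrightarrow> 0 \<le> n t"
    and h_nonneg: "\<And>t. 0 \<le> t \<Longrightarrow> 0 \<le> h t"
    and n_le: "\<And>t. 0 \<le> t \<Longrightarrow> n t \<le> 2 * E t"
    and k_le: "\<And>t. 0 \<le> t \<Longrightarrow> (k t)\<^sup>2 \<le> 2 * h t * n t"
    and k'_le: "AE t in lebesgue_on {0..}. k' t + \<gamma> t * k t \<le> 3/2 * n t - E t"
    and g_ge: "\<And>t. 0 \<le> t \<Longrightarrow> K \<le> (1 + t) powr \<alpha> * \<gamma> t"
    and g'_le: "AE t in lebesgue_on {t0..}. (1 + t) * \<gamma>' t \<le> - \<alpha> * \<gamma> t"
begin

lemma E_nonneg: "0 \<le> t \<Longrightarrow> 0 \<le> E t"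
  using n_le[of t] n_nonneg[of t] by simp

lemma k_le_E: "0 \<le> t \<Longrightarrow> (k t)\<^sup>2 \<le> 4 * h t * E t"
  using k_le[of t] mult_left_mono[OF n_le[of t], of "2 * h t"] h_nonneg[of t]
  by (simp add: mult_ac)

text \<open>
  With \<open>s = 1 + t\<close> and \<open>\<lambda> = s powr r\<close>, the Lyapunov function is \<open>\<lambda> E + \<lambda>' k + (\<lambda>' \<gamma> - \<lambda>'') h\<close>. The
  term \<open>\<lambda>' E\<close> created by differentiating the weight is absorbed by the inequality for \<open>k'\<close>, which
  costs \<open>3/2 * \<lambda>' n\<close>; this is dominated by the dissipation \<open>\<lambda> \<gamma> n\<close> because \<open>s * \<gamma> t\<close> tends to infinity
  (here \<open>\<alpha> < 1\<close> enters). What remains is \<open>((\<lambda>' \<gamma>)' - \<lambda>''') h\<close>, and \<open>r < 1 + \<alpha>\<close> is exactly what makes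
  \<open>(\<lambda>' \<gamma>)'\<close> negative and larger in size than \<open>\<lambda>'''\<close>. For large times the Lyapunov function also controls
  \<open>\<lambda> E\<close> and \<open>\<lambda>' \<gamma> h\<close> from above, whence both bounds. In the proof the factor \<open>p t = s powr (r - 2)\<close> is
  taken out, so that the cofactor \<open>Q\<close> is polynomial in \<open>s\<close>.
\<close>

lemma energy_and_distance_bounds:
  assumes r: "0 < r" "r < 1 + \<alpha>"
  shows "\<exists>T C. 0 \<le> T \<and> 0 \<le> C \<and> (\<forall>t\<ge>T. E t \<le> C * (1 + t) powr (- r))
    \<and> (\<forall>t\<ge>T. h t \<le> C * (1 + t) powr (1 + \<alpha> - r))"
proof -
  \<comment> \<open>From time \<open>T\<close> on, \<open>(1 + t) * \<gamma> t \<ge> B\<close>: the first summand of \<open>B\<close> gives positivity of \<open>Q\<close> and the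
     sign of the coefficient of \<open>n\<close> in the derivative, the second one that of the coefficient of \<open>h\<close>.\<close>
  define B where "B = 4 * r + 1 / (1 + \<alpha> - r)"
  have B: "B \<ge> 4 * r" "B * (1 + \<alpha> - r) \<ge> 1"
    using r by (simp_all add: B_def distrib_right)
  define T where "T = max t0 ((B / K) powr (1 / (1 - \<alpha>)))"
  have T: "T \<ge> t0" "T \<ge> 0" using t0 by (auto simp: T_def)
  have g: "(1 + t) * \<gamma> t \<ge> K * (1 + t) powr (1 - \<alpha>)" if "t \<ge> 0" for t
  proof -
    have "K * (1 + t) powr (1 - \<alpha>) \<le> (1 + t) powr \<alpha> * \<gamma> t * (1 + t) powr (1 - \<alpha>)"
      using g_ge[OF that] by (intro mult_right_mono) auto
    also have "\<dots> = (1 + t) * \<gamma> t"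
      using that by (simp add: mult_ac flip: powr_add)
    finally show ?thesis .
  qed
  have c: "(1 + t) * \<gamma> t \<ge> B" if "t \<ge> T" for t
  proof -
    have t: "t \<ge> 0" using that T by simp
    have "(B / K) powr (1 / (1 - \<alpha>)) \<le> 1 + t" using that by (simp add: T_def)
    then have "((B / K) powr (1 / (1 - \<alpha>))) powr (1 - \<alpha>) \<le> (1 + t) powr (1 - \<alpha>)"
      using alpha by (intro powr_mono2) auto
    then have "B / K \<le> (1 + t) powr (1 - \<alpha>)"
      using alpha B r K_pos by (simp add: powr_powr)
    then have "B \<le> K * (1 + t) powr (1 - \<alpha>)"
      using K_pos by (simp add: field_simps)
    with g[OF t] show ?thesis by simp
  qed
  define p where "p t = (1 + t) powr (r - 2)" for t :: real
  define Q where "Q t = (1 + t) * ((1 + t) * E t) + r * ((1 + t) * k t)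
      + (r * ((1 + t) * \<gamma> t) + (- (r * (r - 1)))) * h t" for t
  have "weak_deriv (\<lambda>t. p t * Q t) (\<lambda>t. (r - 2) * (1 + t) powr (r - 2 - 1) * Q t
    + p t * ((1 * ((1 + t) * E t) + (1 + t) * (1 * E t + (1 + t) * (- (\<gamma> t * n t))))
           + (0 * ((1 + t) * k t) + r * (1 * k t + (1 + t) * k' t))
           + (((0 * ((1 + t) * \<gamma> t) + r * (1 * \<gamma> t + (1 + t) * \<gamma>' t)) + 0) * h t
              + (r * ((1 + t) * \<gamma> t) + (- (r * (r - 1)))) * k t)))" (is "weak_deriv _ ?D")
    unfolding p_def Q_def
    by (intro weak_deriv_mult weak_deriv_add weak_deriv_powr weak_deriv_shift weak_deriv_const
        E_deriv h_deriv k_deriv g_deriv)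
  moreover have "AE t in lebesgue_on {T..}. ?D t \<le> 0"
  proof -
    have "AE t in lebesgue_on {T..}. k' t + \<gamma> t * k t \<le> 3/2 * n t - E t"
      by (rule AE_lebesgue_on_subset[OF k'_le]) (use T in auto)
    moreover have "AE t in lebesgue_on {T..}. (1 + t) * \<gamma>' t \<le> - \<alpha> * \<gamma> t"
      by (rule AE_lebesgue_on_subset[OF g'_le]) (use T in auto)
    moreover have "AE t in lebesgue_on {T..}. T \<le> t"
      by (rule AE_I2) simp
    ultimately show ?thesis
    proof eventually_elim
      case (elim t)
      define s where "s = 1 + t"
      have t: "t \<ge> 0" and s: "s > 0" using elim T by (auto simp: s_def)
      have cs: "s * \<gamma> t \<ge> B" using c elim by (simp add: s_def)
      have p: "s powr (r - 2 - 1) = p t / s" "p t > 0"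
        using s powr_diff[of s "r - 2" 1] by (simp_all add: p_def s_def)
      have D: "?D t = p t / s * ((r - 2) * Q t + s * (2 * s * E t - s * s * (\<gamma> t * n t)
          + r * k t + r * s * k' t + (r * \<gamma> t + r * s * \<gamma>' t) * h t
          + (r * s * \<gamma> t - r * (r - 1)) * k t))"
        unfolding s_def[symmetric] p(1) using s by (simp add: field_simps)
      have "(r - 2) * Q t + s * (2 * s * E t - s * s * (\<gamma> t * n t)
          + r * k t + r * s * k' t + (r * \<gamma> t + r * s * \<gamma>' t) * h t
          + (r * s * \<gamma> t - r * (r - 1)) * k t)
        = r * s * s * (k' t + \<gamma> t * k t + E t) - s * s * (s * \<gamma> t) * n t
          + h t * ((r - 2) * (r * (s * \<gamma> t) - r * (r - 1)) + r * (s * \<gamma> t) + r * s * (s * \<gamma>' t))"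
        unfolding Q_def s_def[symmetric] by (simp add: algebra_simps)
      also have "\<dots> \<le> r * s * s * (3/2 * n t) - s * s * (3/2 * r) * n t
          + h t * ((r - 2) * (r * (s * \<gamma> t) - r * (r - 1)) + r * (s * \<gamma> t) + r * s * (- \<alpha> * \<gamma> t))"
      proof -
        have "r * s * s * (k' t + \<gamma> t * k t + E t) \<le> r * s * s * (3/2 * n t)"
          using elim r s by (intro mult_left_mono) auto
        moreover have "s * s * (3/2 * r) * n t \<le> s * s * (s * \<gamma> t) * n t"
          using s cs B r n_nonneg[OF t] by (intro mult_right_mono mult_left_mono) auto
        moreover have "h t * ((r - 2) * (r * (s * \<gamma> t) - r * (r - 1)) + r * (s * \<gamma> t) + r * s * (s * \<gamma>' t))
          \<le> h t * ((r - 2) * (r * (s * \<gamma> t) - r * (r - 1)) + r * (s * \<gamma> t) + r * s * (- \<alpha> * \<gamma> t))"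
          using elim r s h_nonneg[OF t] by (intro mult_left_mono add_left_mono) (auto simp: s_def)
        ultimately show ?thesis by linarith
      qed
      also have "\<dots> = - (h t * (r * ((1 + \<alpha> - r) * (s * \<gamma> t) + (r - 1) * (r - 2))))"
        by (simp add: algebra_simps)
      also have "\<dots> \<le> 0"
      proof -
        have "1 \<le> (1 + \<alpha> - r) * B" using B by (simp add: mult.commute)
        also have "\<dots> \<le> (1 + \<alpha> - r) * (s * \<gamma> t)"
          using cs r by (intro mult_left_mono) auto
        finally have "1 \<le> (1 + \<alpha> - r) * (s * \<gamma> t)" .
        moreover have "0 \<le> (r - 3/2) * (r - 3/2)" by simp
        then have "(r - 1) * (r - 2) \<ge> - (1/4)" by (simp add: algebra_simps)
        ultimately have "0 \<le> (1 + \<alpha> - r) * (s * \<gamma> t) + (r - 1) * (r - 2)" by linarith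
        then show ?thesis using r h_nonneg[OF t] by simp
      qed
      finally show "?D t \<le> 0"
        unfolding D using p s by (intro mult_nonneg_nonpos) auto
    qed
  qed
  ultimately have dec: "p t * Q t \<le> p T * Q T" if "T \<le> t" for t
    using weak_deriv_nonpos_imp_le[of "\<lambda>t. p t * Q t" ?D T T t] T that by simp
  have Q: "(1 + t) * (1 + t) * E t / 2 + r / 4 * ((1 + t) * \<gamma> t) * h t \<le> Q t" if "T \<le> t" for t
  proof -
    define s where "s = 1 + t"
    define c where "c = s * \<gamma> t"
    have t: "t \<ge> 0" and s: "s > 0" using that T by (auto simp: s_def)
    have c: "c \<ge> 4 * r" using c[OF that] B by (simp add: s_def c_def)
    have "(r * s * k t)\<^sup>2 = (r * s)\<^sup>2 * (k t)\<^sup>2" by (simp add: power_mult_distrib)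
    also have "\<dots> \<le> (r * s)\<^sup>2 * (4 * h t * E t)"
      using k_le_E[OF t] by (intro mult_left_mono) auto
    also have "\<dots> = (4 * r) * (r * s\<^sup>2 * h t * E t)" by (simp add: power2_eq_square)
    also have "\<dots> \<le> c * (r * s\<^sup>2 * h t * E t)"
      using c r h_nonneg[OF t] E_nonneg[OF t] by (intro mult_right_mono) auto
    also have "\<dots> = 4 * (s\<^sup>2 * E t / 2) * (r * c * h t / 2)" by simp
    also have "\<dots> \<le> (s\<^sup>2 * E t / 2 + r * c * h t / 2)\<^sup>2"
    proof -
      have "4 * x * y \<le> (x + y)\<^sup>2" for x y :: real
        using sum_squares_bound[of x y] by (simp add: power2_sum)
      then show ?thesis .
    qed
    finally have "\<bar>r * s * k t\<bar> \<le> s\<^sup>2 * E t / 2 + r * c * h t / 2"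
      by (rule abs_le_square_iff[THEN iffD2, THEN order_trans[OF _ eq_refl[OF abs_of_nonneg]]])
        (use c r s h_nonneg[OF t] E_nonneg[OF t] in simp)
    moreover have "r * (r - 1) * h t \<le> r * (c / 4) * h t"
      using c r h_nonneg[OF t] by (intro mult_right_mono mult_left_mono) auto
    ultimately show ?thesis
      unfolding Q_def s_def[symmetric] c_def[symmetric]
      by (simp add: power2_eq_square algebra_simps)
  qed
  define L where "L = \<bar>p T * Q T\<bar>"
  define C where "C = 2 * L + 4 * L / (r * K)"
  have L: "L \<ge> 0" by (simp add: L_def)
  have C: "2 * L \<le> C" "4 * L / (r * K) \<le> C" "C \<ge> 0"
    using L r K_pos by (auto simp: C_def)
  show ?thesis
  proof (intro exI conjI allI impI)
    show "0 \<le> T" "0 \<le> C" using T C by auto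
    fix t assume tT: "T \<le> t"
    then have t: "t \<ge> 0" using T by simp
    have p: "p t > 0" using t by (simp add: p_def)
    have "p t * ((1 + t) * (1 + t) * E t / 2 + r / 4 * ((1 + t) * \<gamma> t) * h t) \<le> p t * Q t"
      using Q[OF tT] p by (intro mult_left_mono) auto
    also have "\<dots> \<le> L" using dec[OF tT] by (simp add: L_def)
    finally have le: "p t * ((1 + t) * (1 + t) * E t / 2) + p t * (r / 4 * ((1 + t) * \<gamma> t) * h t) \<le> L"
      by (simp add: distrib_left)
    have ge: "p t * (r / 4 * ((1 + t) * \<gamma> t) * h t) \<ge> p t * (r / 4 * (K * (1 + t) powr (1 - \<alpha>)) * h t)"
      using g[OF t] p r h_nonneg[OF t] by (intro mult_left_mono mult_right_mono) auto
    have pos1: "p t * (r / 4 * (K * (1 + t) powr (1 - \<alpha>)) * h t) \<ge> 0"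
      using p r K_pos h_nonneg[OF t] by simp
    have pos2: "p t * ((1 + t) * (1 + t) * E t / 2) \<ge> 0"
      using p t E_nonneg[OF t] by simp
    have "p t * ((1 + t) * (1 + t)) = (1 + t) powr r"
      using t by (simp add: p_def powr_diff power2_eq_square)
    moreover have "p t * ((1 + t) * (1 + t) * E t / 2) = p t * ((1 + t) * (1 + t)) * E t / 2"
      by simp
    ultimately have "p t * ((1 + t) * (1 + t) * E t / 2) = (1 + t) powr r * E t / 2"
      by (simp only:)
    then have "(1 + t) powr r * E t \<le> 2 * L" using le ge pos1 by linarith
    then have "(1 + t) powr r * E t \<le> C" using C by simp
    then show "E t \<le> C * (1 + t) powr (- r)"
      using t by (simp add: powr_minus field_simps)
    have "p t * (1 + t) powr (1 - \<alpha>) = (1 + t) powr ((r - 2) + (1 - \<alpha>))"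
      unfolding p_def powr_add ..
    also have "(r - 2) + (1 - \<alpha>) = - (1 + \<alpha> - r)" by simp
    finally have "p t * (1 + t) powr (1 - \<alpha>) = (1 + t) powr (- (1 + \<alpha> - r))" .
    moreover have "p t * (r / 4 * (K * (1 + t) powr (1 - \<alpha>)) * h t)
        = r * K / 4 * (p t * (1 + t) powr (1 - \<alpha>) * h t)"
      by simp
    ultimately have "p t * (r / 4 * (K * (1 + t) powr (1 - \<alpha>)) * h t)
        = r * K / 4 * ((1 + t) powr (- (1 + \<alpha> - r)) * h t)"
      by (simp only:)
    then have "r * K / 4 * ((1 + t) powr (- (1 + \<alpha> - r)) * h t) \<le> L"
      using le ge pos2 by linarith
    then have "(1 + t) powr (- (1 + \<alpha> - r)) * h t \<le> 4 * L / (r * K)"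
      using r K_pos by (simp add: field_simps)
    then have "(1 + t) powr (- (1 + \<alpha> - r)) * h t \<le> C" using C by simp
    then show "h t \<le> C * (1 + t) powr (1 + \<alpha> - r)"
      using t by (subst (asm) powr_minus) (simp add: field_simps)
  qed
qed

lemma scaled_damping_deriv:
  "weak_deriv (\<lambda>t. (1 + t) powr \<alpha> * \<gamma> t) (\<lambda>t. \<alpha> * (1 + t) powr (\<alpha> - 1) * \<gamma> t + (1 + t) powr \<alpha> * \<gamma>' t)"
  by (intro weak_deriv_mult weak_deriv_powr g_deriv)

lemma scaled_damping_deriv_nonpos:
  "AE t in lebesgue_on {t0..}. \<alpha> * (1 + t) powr (\<alpha> - 1) * \<gamma> t + (1 + t) powr \<alpha> * \<gamma>' t \<le> 0"
proof -
  have "AE t in lebesgue_on {t0..}. t0 \<le> t" by (rule AE_I2) simp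
  with g'_le show ?thesis
  proof eventually_elim
    case (elim t)
    then have s: "1 + t > 0" using t0 by simp
    have "\<alpha> * (1 + t) powr (\<alpha> - 1) * \<gamma> t + (1 + t) powr \<alpha> * \<gamma>' t
        = (1 + t) powr \<alpha> / (1 + t) * (\<alpha> * \<gamma> t + (1 + t) * \<gamma>' t)"
      using s by (simp add: powr_diff field_simps)
    also have "\<dots> \<le> 0" using elim s by (intro mult_nonneg_nonpos) auto
    finally show ?case .
  qed
qed

lemma scaled_damping_convergent:
  obtains l where "0 < l" "((\<lambda>t. (1 + t) powr \<alpha> * \<gamma> t) \<longlongrightarrow> l) at_top"
proof -
  have "\<exists>l\<ge>K. ((\<lambda>t. (1 + t) powr \<alpha> * \<gamma> t) \<longlongrightarrow> l) at_top"
    by (rule decreasing_bdd_below_imp_convergent[where T = t0])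
      (use g_ge t0 weak_deriv_nonpos_imp_le[OF scaled_damping_deriv scaled_damping_deriv_nonpos t0] in auto)
  then obtain l where "K \<le> l" "((\<lambda>t. (1 + t) powr \<alpha> * \<gamma> t) \<longlongrightarrow> l) at_top" by blast
  with K_pos show ?thesis by (intro that[of l]) auto
qed

text \<open>
  Write \<open>G = (1 + t) powr \<alpha> * \<gamma> t\<close>, which decreases to a positive limit. The function
  \<open>(1 + t) powr \<alpha> * k t + G t * h t\<close> has derivative at most
  \<open>3/2 * (1 + t) powr \<alpha> * n t + \<alpha> * (1 + t) powr (\<alpha> - 1) * \<bar>k t\<bar>\<close>, because \<open>G' \<le> 0 \<le> h\<close>. Adding a multiple of
  \<open>(1 + t) powr (2 * \<alpha>) * E t\<close> compensates the first term by dissipation. By the bounds for an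
  exponent \<open>r\<close> close to \<open>1 + \<alpha>\<close>, what remains is \<open>O((1 + t) powr (- 1 - \<epsilon>))\<close>, compensated by a multiple of
  \<open>(1 + t) powr (- \<epsilon>)\<close>. The resulting function \<open>\<Psi>\<close> decreases and is bounded below, and all its
  summands other than \<open>G * h\<close> tend to \<open>0\<close>.
\<close>

lemma distance_convergent: "\<exists>l. (h \<longlongrightarrow> l) at_top"
proof -
  \<comment> \<open>With exponent \<open>r = 1 + \<alpha> - \<epsilon>\<close> and this \<open>\<epsilon>\<close>, the bounds give \<open>(1 + t) powr \<alpha> * k t = O((1 + t) powr (- \<epsilon>))\<close>.\<close>
  define \<epsilon> where "\<epsilon> = (1 - \<alpha>) / 4"
  have eps: "\<epsilon> > 0" "\<epsilon> < 1" "1 + \<alpha> - \<epsilon> > 0" using alpha by (auto simp: \<epsilon>_def)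
  obtain T0 C where T0: "0 \<le> T0" and C: "0 \<le> C"
    and Eb: "\<And>t. T0 \<le> t \<Longrightarrow> E t \<le> C * (1 + t) powr (- (1 + \<alpha> - \<epsilon>))"
    and hb: "\<And>t. T0 \<le> t \<Longrightarrow> h t \<le> C * (1 + t) powr (1 + \<alpha> - (1 + \<alpha> - \<epsilon>))"
    using energy_and_distance_bounds[of "1 + \<alpha> - \<epsilon>"] eps by auto
  define T where "T = max t0 T0"
  have T: "T \<ge> t0" "T \<ge> T0" "T \<ge> 0" using T0 by (auto simp: T_def)
  have xk: "(1 + t) powr \<alpha> * \<bar>k t\<bar> \<le> 2 * C * (1 + t) powr (- \<epsilon>)" if "T \<le> t" for t
  proof -
    have t: "t \<ge> 0" "T0 \<le> t" using that T by auto
    have "((1 + t) powr \<alpha> * \<bar>k t\<bar>)\<^sup>2 = (1 + t) powr (2 * \<alpha>) * (k t)\<^sup>2"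
      using powr_add[of "1 + t" \<alpha> \<alpha>] by (simp add: power_mult_distrib power2_eq_square)
    also have "\<dots> \<le> (1 + t) powr (2 * \<alpha>) * (4 * (C * (1 + t) powr \<epsilon>) * (C * (1 + t) powr (- (1 + \<alpha> - \<epsilon>))))"
      using Eb[OF t(2)] hb[OF t(2)] C h_nonneg[OF t(1)] E_nonneg[OF t(1)]
      by (intro mult_left_mono order_trans[OF k_le_E[OF t(1)]] mult_mono) auto
    also have "\<dots> = 4 * C\<^sup>2 * (1 + t) powr (2 * \<alpha> + \<epsilon> + (- (1 + \<alpha> - \<epsilon>)))"
      unfolding powr_add by (simp add: power2_eq_square)
    also have "2 * \<alpha> + \<epsilon> + (- (1 + \<alpha> - \<epsilon>)) = - \<epsilon> + - \<epsilon>"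
      by (simp add: \<epsilon>_def field_simps)
    also have "4 * C\<^sup>2 * (1 + t) powr (- \<epsilon> + - \<epsilon>) = (2 * C * (1 + t) powr (- \<epsilon>))\<^sup>2"
      unfolding powr_add by (simp add: power2_eq_square)
    finally show ?thesis
      by (rule power2_le_imp_le) (use C in simp)
  qed
  have xE: "(1 + t) powr (2 * \<alpha>) * E t \<le> C * (1 + t) powr (- \<epsilon>)" if "T \<le> t" for t
  proof -
    have t: "t \<ge> 0" "T0 \<le> t" using that T by auto
    have "(1 + t) powr (2 * \<alpha>) * E t \<le> (1 + t) powr (2 * \<alpha>) * (C * (1 + t) powr (- (1 + \<alpha> - \<epsilon>)))"
      by (intro mult_left_mono Eb t) auto
    also have "\<dots> = C * (1 + t) powr (2 * \<alpha> + (- (1 + \<alpha> - \<epsilon>)))"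
      unfolding powr_add by simp
    also have "\<dots> \<le> C * (1 + t) powr (- \<epsilon>)"
      using alpha t C by (intro mult_left_mono powr_mono) (auto simp: \<epsilon>_def field_simps)
    finally show ?thesis .
  qed
  define M where "M = 2 * \<alpha> * C + 3 * \<alpha> * C / K"
  define \<Psi> where "\<Psi> t = (1 + t) powr \<alpha> * k t + (1 + t) powr \<alpha> * \<gamma> t * h t
      + 3 / (2 * K) * ((1 + t) powr (2 * \<alpha>) * E t) + M / \<epsilon> * (1 + t) powr (- \<epsilon>)" for t
  have "weak_deriv \<Psi> (\<lambda>t. (\<alpha> * (1 + t) powr (\<alpha> - 1) * k t + (1 + t) powr \<alpha> * k' t)
     + ((\<alpha> * (1 + t) powr (\<alpha> - 1) * \<gamma> t + (1 + t) powr \<alpha> * \<gamma>' t) * h t + (1 + t) powr \<alpha> * \<gamma> t * k t)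
     + (0 * ((1 + t) powr (2 * \<alpha>) * E t)
         + 3 / (2 * K) * (2 * \<alpha> * (1 + t) powr (2 * \<alpha> - 1) * E t + (1 + t) powr (2 * \<alpha>) * (- (\<gamma> t * n t))))
     + (0 * (1 + t) powr (- \<epsilon>) + M / \<epsilon> * (- \<epsilon> * (1 + t) powr (- \<epsilon> - 1))))"
    (is "weak_deriv _ ?D")
    unfolding \<Psi>_def
    by (intro weak_deriv_mult weak_deriv_add weak_deriv_powr weak_deriv_const
        scaled_damping_deriv E_deriv h_deriv k_deriv)
  moreover have "AE t in lebesgue_on {T..}. ?D t \<le> 0"
  proof -
    have "AE t in lebesgue_on {T..}. k' t + \<gamma> t * k t \<le> 3/2 * n t - E t"
      by (rule AE_lebesgue_on_subset[OF k'_le]) (use T in auto)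
    moreover have "AE t in lebesgue_on {T..}. \<alpha> * (1 + t) powr (\<alpha> - 1) * \<gamma> t + (1 + t) powr \<alpha> * \<gamma>' t \<le> 0"
      by (rule AE_lebesgue_on_subset[OF scaled_damping_deriv_nonpos]) (use T in auto)
    moreover have "AE t in lebesgue_on {T..}. T \<le> t"
      by (rule AE_I2) simp
    ultimately show ?thesis
    proof eventually_elim
      case (elim t)
      define s x z where "s = 1 + t" and "x = (1 + t) powr \<alpha>" and "z = (1 + t) powr (- \<epsilon> - 1)"
      have t: "t \<ge> 0" and s: "s > 0" and x: "x > 0" using elim T by (auto simp: s_def x_def)
      have e1: "(1 + t) powr (\<alpha> - 1) = x / s" and e2: "(1 + t) powr (2 * \<alpha>) = x * x"
        and e3: "(1 + t) powr (2 * \<alpha> - 1) = x * x / s" and e4: "(1 + t) powr (- \<epsilon>) = z * s"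
        using s by (simp_all add: x_def s_def z_def powr_diff flip: powr_add)
      have "x / s * k t \<le> 2 * C * z"
      proof -
        have "x * k t \<le> x * \<bar>k t\<bar>" using x by (intro mult_left_mono) auto
        also have "\<dots> \<le> 2 * C * (z * s)" using xk[of t] elim by (simp add: x_def e4)
        finally show ?thesis using s by (simp add: field_simps)
      qed
      then have 1: "\<alpha> * (x / s) * k t \<le> 2 * \<alpha> * C * z"
        using mult_left_mono[of "x / s * k t" "2 * C * z" \<alpha>] alpha by (simp add: mult_ac)
      have "x * x * E t \<le> C * (z * s)"
        using xE[OF elim(3)] unfolding e2 e4 .
      then have "x * x / s * E t \<le> C * z"
        using s by (simp add: field_simps)
      then have 2: "3 / (2 * K) * (2 * \<alpha> * (x * x / s) * E t) \<le> 3 * \<alpha> * C / K * z"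
        using mult_left_mono[of "x * x / s * E t" "C * z" "3 * \<alpha> / K"] alpha K_pos by (simp add: mult_ac)
      have "x * (k' t + \<gamma> t * k t) \<le> x * (3/2 * n t)"
        using elim x E_nonneg[OF t] by (intro mult_left_mono) auto
      then have 3: "x * k' t + x * \<gamma> t * k t \<le> 3/2 * (x * n t)" by (simp add: algebra_simps)
      have "K * (x * n t) \<le> (x * \<gamma> t) * (x * n t)"
        using g_ge[OF t] x n_nonneg[OF t] by (intro mult_right_mono) (auto simp: x_def)
      then have 4: "3/2 * (x * n t) \<le> 3 / (2 * K) * (x * x * (\<gamma> t * n t))"
        using K_pos by (simp add: field_simps)
      have 5: "(\<alpha> * (x / s) * \<gamma> t + x * \<gamma>' t) * h t \<le> 0"
        using elim h_nonneg[OF t] by (intro mult_nonpos_nonneg) (auto simp: e1 x_def)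
      have "?D t = (\<alpha> * (x / s) * k t) + (x * k' t + x * \<gamma> t * k t) + (\<alpha> * (x / s) * \<gamma> t + x * \<gamma>' t) * h t
          + 3 / (2 * K) * (2 * \<alpha> * (x * x / s) * E t) - 3 / (2 * K) * (x * x * (\<gamma> t * n t)) - M * z"
        unfolding e1 e2 e3 x_def[symmetric] z_def[symmetric] using eps by (simp add: algebra_simps)
      also have "M * z = 2 * \<alpha> * C * z + 3 * \<alpha> * C / K * z"
        by (simp add: M_def distrib_right)
      finally show "?D t \<le> 0" using 1 2 3 4 5 by linarith
    qed
  qed
  ultimately have dec: "\<Psi> t \<le> \<Psi> s" if "T \<le> s" "s \<le> t" for s t
    using weak_deriv_nonpos_imp_le[of \<Psi> ?D T s t] T that by blast
  have low: "- (2 * C) \<le> \<Psi> t" if "T \<le> t" for t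
  proof -
    have t: "t \<ge> 0" using that T by simp
    have "2 * C * (1 + t) powr (- \<epsilon>) \<le> 2 * C * 1"
      using t eps C powr_mono[of "-\<epsilon>" 0 "1 + t"] by (intro mult_left_mono) auto
    then have "- (2 * C) \<le> - ((1 + t) powr \<alpha> * \<bar>k t\<bar>)" using xk[OF that] by simp
    also have "\<dots> \<le> (1 + t) powr \<alpha> * k t"
      using mult_left_mono[of "- \<bar>k t\<bar>" "k t" "(1 + t) powr \<alpha>"] by simp
    also have "\<dots> \<le> \<Psi> t"
    proof -
      have "0 \<le> (1 + t) powr \<alpha> * \<gamma> t * h t"
        by (rule mult_nonneg_nonneg[OF _ h_nonneg[OF t]]) (use g_ge[OF t] K_pos in linarith)
      moreover have "0 \<le> 3 / (2 * K) * ((1 + t) powr (2 * \<alpha>) * E t)"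
        using K_pos E_nonneg[OF t] by simp
      moreover have "0 \<le> M / \<epsilon> * (1 + t) powr (- \<epsilon>)"
        using K_pos C alpha eps by (simp add: M_def)
      ultimately show ?thesis by (simp add: \<Psi>_def)
    qed
    finally show ?thesis .
  qed
  obtain l where l: "(\<Psi> \<longlongrightarrow> l) at_top"
    using decreasing_bdd_below_imp_convergent[of T \<Psi> "- (2 * C)"] dec low by blast
  have pz: "((\<lambda>t. c * (1 + t) powr (- \<epsilon>)) \<longlongrightarrow> 0) at_top" for c :: real
  proof -
    have "filterlim (\<lambda>t::real. 1 + t) at_top at_top"
      by (intro filterlim_tendsto_add_at_top[OF tendsto_const] filterlim_ident)
    from tendsto_neg_powr[OF _ this, of "-\<epsilon>"] have "((\<lambda>t::real. (1 + t) powr (- \<epsilon>)) \<longlongrightarrow> 0) at_top"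
      using eps by simp
    from tendsto_mult_right_zero[OF this] show ?thesis .
  qed
  have "((\<lambda>t. (1 + t) powr \<alpha> * k t) \<longlongrightarrow> 0) at_top"
  proof (rule Lim_null_comparison[OF _ pz[of "2 * C"]])
    show "\<forall>\<^sub>F t in at_top. norm ((1 + t) powr \<alpha> * k t) \<le> 2 * C * (1 + t) powr (- \<epsilon>)"
      using eventually_ge_at_top[of T] by eventually_elim (use xk in \<open>simp add: abs_mult\<close>)
  qed
  moreover have "((\<lambda>t. (1 + t) powr (2 * \<alpha>) * E t) \<longlongrightarrow> 0) at_top"
  proof (rule Lim_null_comparison[OF _ pz[of C]])
    show "\<forall>\<^sub>F t in at_top. norm ((1 + t) powr (2 * \<alpha>) * E t) \<le> C * (1 + t) powr (- \<epsilon>)"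
      using eventually_ge_at_top[of T]
      by eventually_elim (use xE T E_nonneg in \<open>simp add: abs_mult\<close>)
  qed
  ultimately have "((\<lambda>t. \<Psi> t - (1 + t) powr \<alpha> * k t - 3 / (2 * K) * ((1 + t) powr (2 * \<alpha>) * E t)
      - M / \<epsilon> * (1 + t) powr (- \<epsilon>)) \<longlongrightarrow> l - 0 - 3 / (2 * K) * 0 - 0) at_top"
    by (intro tendsto_intros l pz)
  then have gh: "((\<lambda>t. (1 + t) powr \<alpha> * \<gamma> t * h t) \<longlongrightarrow> l) at_top"
    by (simp add: \<Psi>_def)
  obtain m where m: "0 < m" "((\<lambda>t. (1 + t) powr \<alpha> * \<gamma> t) \<longlongrightarrow> m) at_top"
    by (rule scaled_damping_convergent)
  have "((\<lambda>t. (1 + t) powr \<alpha> * \<gamma> t * h t / ((1 + t) powr \<alpha> * \<gamma> t)) \<longlongrightarrow> l / m) at_top"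
    using m by (intro tendsto_divide gh) auto
  moreover have "\<forall>\<^sub>F t in at_top. (1 + t) powr \<alpha> * \<gamma> t * h t / ((1 + t) powr \<alpha> * \<gamma> t) = h t"
    using eventually_ge_at_top[of 0]
  proof eventually_elim
    case (elim t)
    then have "(1 + t) powr \<alpha> * \<gamma> t \<noteq> 0" using g_ge[of t] K_pos by force
    then show ?case by simp
  qed
  ultimately have "(h \<longlongrightarrow> l / m) at_top" by (rule Lim_transform_eventually)
  then show ?thesis by blast
qed

end

section \<open>Weak convergence in a Hilbert space\<close>

text \<open>
  Points of almost minimal norm in the sets \<open>D n\<close> form a Cauchy sequence: midpoints stay in the
  larger set, so the parallelogram law bounds the distance of two such points by the increase of the
  minimal norms, which are monotone and bounded. This takes the place of weak compactness of
  bounded sets.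
\<close>

lemma bounded_closed_convex_decseq_Inter_nonempty:
  fixes D :: "nat \<Rightarrow> 'a::{real_inner,banach} set"
  assumes clo: "\<And>n. closed (D n)" and conv: "\<And>n. convex (D n)" and ne: "\<And>n. D n \<noteq> {}"
    and dec: "decseq D" and bdd: "bounded (D 0)"
  shows "(\<Inter>n. D n) \<noteq> {}"
proof -
  define q where "q n = Inf ((\<lambda>x. (norm x)\<^sup>2) ` D n)" for n
  define \<iota> where "\<iota> n = inverse (real (Suc n))" for n
  have \<iota>: "\<iota> n > 0" "n \<le> m \<Longrightarrow> \<iota> m \<le> \<iota> n" for n m by (auto simp: \<iota>_def)
  have \<iota>lim: "\<iota> \<longlonglongrightarrow> 0" unfolding \<iota>_def[abs_def] by (rule LIMSEQ_inverse_real_of_nat)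
  have below: "bdd_below ((\<lambda>x. (norm x)\<^sup>2) ` D n)" for n
    by (rule bdd_belowI2[of _ 0]) simp
  have sub: "D m \<subseteq> D n" if "n \<le> m" for n m using dec that by (rule decseqD)
  obtain b where b: "\<And>x. x \<in> D 0 \<Longrightarrow> norm x \<le> b" using bdd unfolding bounded_iff by blast
  have q_le: "q n \<le> (norm x)\<^sup>2" if "x \<in> D n" for n x
    unfolding q_def using that by (intro cInf_lower below) auto
  have "incseq q"
  proof (rule incseq_SucI)
    fix n
    show "q n \<le> q (Suc n)"
      unfolding q_def using sub[of n "Suc n"] ne below by (intro cInf_superset_mono) auto
  qed
  moreover have "\<forall>n. q n \<le> b\<^sup>2"
  proof
    fix n
    obtain x where x: "x \<in> D n" using ne by blast
    have "q n \<le> (norm x)\<^sup>2" by (rule q_le[OF x])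
    also have "\<dots> \<le> b\<^sup>2" using b[of x] x sub[of 0 n] by (intro power_mono) auto
    finally show "q n \<le> b\<^sup>2" .
  qed
  ultimately obtain l where l: "q \<longlonglongrightarrow> l" "\<forall>n. q n \<le> l" by (rule incseq_convergent)
  have "\<exists>x\<in>D n. (norm x)\<^sup>2 < q n + \<iota> n" for n
    using cInf_lessD[of "(\<lambda>x. (norm x)\<^sup>2) ` D n" "q n + \<iota> n"] ne[of n]
    using \<iota>(1)[of n] by (auto simp: q_def)
  then obtain x where x: "\<And>n. x n \<in> D n" "\<And>n. (norm (x n))\<^sup>2 < q n + \<iota> n"
    by metis
  have close: "(norm (x n - x m))\<^sup>2 \<le> 4 * (l - q n) + 4 * \<iota> n" if "n \<le> m" for n m
  proof -
    have "x m \<in> D n" using x(1)[of m] sub[OF that] by blast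
    then have "(1/2) *\<^sub>R x n + (1/2) *\<^sub>R x m \<in> D n"
      using x(1) by (intro convexD[OF conv]) auto
    from q_le[OF this] have "q n \<le> (norm ((1/2) *\<^sub>R (x n + x m)))\<^sup>2"
      by (simp add: scaleR_add_right)
    then have mid: "4 * q n \<le> (norm (x n + x m))\<^sup>2" by (simp add: power_mult_distrib power2_eq_square)
    have "(norm (x n - x m))\<^sup>2 = 2 * ((norm (x n))\<^sup>2 + (norm (x m))\<^sup>2) - (norm (x n + x m))\<^sup>2"
      by (simp add: power2_norm_eq_inner inner_add inner_diff inner_commute)
    also have "\<dots> \<le> 2 * ((q n + \<iota> n) + (l + \<iota> n)) - 4 * q n"
    proof -
      have "(norm (x m))\<^sup>2 \<le> l + \<iota> n" using x(2)[of m] l(2)[rule_format, of m] \<iota>(2)[OF that] by linarith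
      with mid x(2)[of n] show ?thesis by (intro diff_mono mult_left_mono add_mono) auto
    qed
    also have "\<dots> \<le> 4 * (l - q n) + 4 * \<iota> n" using l(2)[rule_format, of n] by simp
    finally show ?thesis .
  qed
  have lim: "(\<lambda>n. 4 * (l - q n) + 4 * \<iota> n) \<longlonglongrightarrow> 4 * (l - l) + 4 * 0"
    by (intro tendsto_intros l \<iota>lim)
  have "Cauchy x"
  proof (rule CauchyI)
    fix e :: real assume e: "0 < e"
    then have "\<forall>\<^sub>F n in sequentially. 4 * (l - q n) + 4 * \<iota> n < e\<^sup>2"
      using order_tendstoD(2)[OF lim, of "e\<^sup>2"] by simp
    then obtain M where M: "\<And>n. n \<ge> M \<Longrightarrow> 4 * (l - q n) + 4 * \<iota> n < e\<^sup>2"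
      unfolding eventually_sequentially by blast
    have less: "norm (x n - x m) < e" if "M \<le> n" "n \<le> m" for n m
      by (rule power2_less_imp_less[OF le_less_trans[OF close[OF that(2)] M[OF that(1)]]]) (use e in simp)
    have "norm (x m - x n) < e" if "M \<le> n" "M \<le> m" for n m
      using less[of n m] less[of m n] that by (cases "n \<le> m") (simp_all add: norm_minus_commute)
    then show "\<exists>M. \<forall>m\<ge>M. \<forall>n\<ge>M. norm (x m - x n) < e" by blast
  qed
  then obtain y where y: "x \<longlonglongrightarrow> y" using Cauchy_convergent convergentD by blast
  have "y \<in> D n" for n
  proof (rule Lim_in_closed_set[OF clo _ _ y])
    show "\<forall>\<^sub>F m in sequentially. x m \<in> D n"
      using eventually_ge_at_top[of n] by eventually_elim (use x(1) sub in blast)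
  qed simp
  then show ?thesis by blast
qed

text \<open>
  The closed convex hulls of all tails have this set in common; it contains every weak cluster point
  of the sequence and inherits every closed convex constraint that holds eventually.
\<close>

definition hull_limits :: "(nat \<Rightarrow> 'a::real_normed_vector) \<Rightarrow> 'a set" where
  "hull_limits x = (\<Inter>n. closure (convex hull (x ` {n..})))"

lemma hull_limits_nonempty:
  fixes x :: "nat \<Rightarrow> 'a::{real_inner,banach}"
  assumes "\<And>n. norm (x n) \<le> R"
  shows "hull_limits x \<noteq> {}"
  unfolding hull_limits_def
proof (rule bounded_closed_convex_decseq_Inter_nonempty)
  show "decseq (\<lambda>n. closure (convex hull (x ` {n..})))"
    by (intro antimonoI closure_mono hull_mono image_mono) auto
  have "bounded (x ` {0..})" using assms by (auto simp: bounded_iff)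
  then show "bounded (closure (convex hull (x ` {0..})))"
    by (intro bounded_closure bounded_convex_hull)
qed (auto simp: convex_closure convex_convex_hull)

lemma hull_limits_in_closed_convex:
  assumes "z \<in> hull_limits x" "closed C" "convex C" and ev: "\<forall>\<^sub>F n in sequentially. x n \<in> C"
  shows "z \<in> C"
proof -
  obtain N where N: "\<And>n. n \<ge> N \<Longrightarrow> x n \<in> C" using ev unfolding eventually_sequentially by blast
  have "closure (convex hull (x ` {N..})) \<subseteq> C"
    by (intro closure_minimal hull_minimal) (use assms N in auto)
  then show ?thesis using assms(1) by (auto simp: hull_limits_def)
qed

lemma hull_limits_functional_ge:
  fixes p :: "'a::real_normed_vector \<Rightarrow> real"
  assumes z: "z \<in> hull_limits x" and p: "bounded_linear p" and ev: "\<forall>\<^sub>F n in sequentially. c \<le> p (x n)"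
  shows "c \<le> p z"
proof -
  interpret p: bounded_linear p by fact
  have "closed {y. c \<le> p y}"
    by (intro closed_Collect_le continuous_intros p.continuous_on)
  moreover have "convex {y. c \<le> p y}"
    using convex_linear_vimage[OF p.linear_axioms, of "{c..}"] by (simp add: vimage_def)
  ultimately show ?thesis
    using hull_limits_in_closed_convex[OF z, of "{y. c \<le> p y}"] ev by simp
qed

lemma hull_limits_functional_eq:
  fixes p :: "'a::real_normed_vector \<Rightarrow> real"
  assumes z: "z \<in> hull_limits x" and p: "bounded_linear p" and lim: "(\<lambda>n. p (x n)) \<longlonglongrightarrow> d"
  shows "p z = d"
proof (rule antisym)
  show "p z \<le> d"
  proof (rule field_le_epsilon)
    fix e :: real assume "e > 0"
    then have "\<forall>\<^sub>F n in sequentially. - (d + e) \<le> - p (x n)"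
      using order_tendstoD(2)[OF lim, of "d + e"] by (auto elim: eventually_mono)
    from hull_limits_functional_ge[OF z bounded_linear_minus[OF p] this]
    show "p z \<le> d + e" by simp
  qed
  show "d \<le> p z"
  proof (rule field_le_epsilon)
    fix e :: real assume "e > 0"
    then have "\<forall>\<^sub>F n in sequentially. d - e \<le> p (x n)"
      using order_tendstoD(1)[OF lim, of "d - e"] by (auto elim: eventually_mono)
    from hull_limits_functional_ge[OF z p this] show "d \<le> p z + e" by simp
  qed
qed

text \<open>
  A version of Opial's lemma. Let \<open>x\<close> and \<open>x'\<close> be hull limits along two sequences of times. Both belong
  to \<open>S\<close>, so the difference of the two squared distances converges; up to constants it is
  \<open>- 2 * (J (u t) \<bullet> w)\<close> with \<open>w = J x - J x'\<close>. The functional \<open>J _ \<bullet> w\<close> thus has the same value at \<open>x\<close> and \<open>x'\<close>,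
  which means \<open>w \<bullet> w = 0\<close> and \<open>x = x'\<close>. If a functional \<open>p\<close> exceeded \<open>p x + e\<close> at arbitrarily late times, a
  hull limit \<open>x'\<close> along those times would satisfy \<open>p x' \<ge> p x + e\<close>.
\<close>

lemma weakly_converges_if_distances_converge:
  fixes u :: "real \<Rightarrow> 'v::{real_inner,banach}" and J :: "'v \<Rightarrow>\<^sub>L 'h::real_inner"
  assumes inj: "inj (blinfun_apply J)"
    and bdd: "\<And>t. T \<le> t \<Longrightarrow> norm (u t) \<le> R"
    and dist: "\<And>z. z \<in> S \<Longrightarrow> \<exists>l. ((\<lambda>t. (norm (J (u t) - J z))\<^sup>2) \<longlongrightarrow> l) at_top"
    and lim: "\<And>s z. filterlim s at_top sequentially \<Longrightarrow> z \<in> hull_limits (\<lambda>n. u (s n)) \<Longrightarrow> z \<in> S"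
  shows "\<exists>x\<in>S. weakly_converges u x at_top"
proof -
  have ex: "\<exists>z\<in>S. z \<in> hull_limits (\<lambda>n. u (s n))"
    if "filterlim s at_top sequentially" "\<And>n. T \<le> s n" for s
    using hull_limits_nonempty[of "\<lambda>n. u (s n)" R] bdd that lim by blast
  define s1 where "s1 n = T + real n" for n
  have s1: "filterlim s1 at_top sequentially"
    unfolding s1_def[abs_def]
    by (intro filterlim_tendsto_add_at_top[OF tendsto_const] filterlim_real_sequentially)
  then obtain x where x: "x \<in> S" "x \<in> hull_limits (\<lambda>n. u (s1 n))"
    using ex[of s1] by (auto simp: s1_def)
  have ev: "\<forall>\<^sub>F t in at_top. p (u t) < p x + e" if p: "bounded_linear p" and e: "e > 0"
    for p :: "'v \<Rightarrow> real" and e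
  proof (rule ccontr)
    assume "\<not> ?thesis"
    then have "\<exists>t\<ge>N. p x + e \<le> p (u t)" for N
      unfolding eventually_at_top_linorder by (meson not_le)
    then have "\<exists>t\<ge>max T (real n). p x + e \<le> p (u t)" for n by blast
    then obtain s2 where s2: "\<And>n. max T (real n) \<le> s2 n" "\<And>n. p x + e \<le> p (u (s2 n))"
      by metis
    have s2lim: "filterlim s2 at_top sequentially"
      by (rule filterlim_at_top_mono[OF filterlim_real_sequentially])
        (use s2(1) in \<open>auto intro!: always_eventually\<close>)
    with s2(1) obtain x' where x': "x' \<in> S" "x' \<in> hull_limits (\<lambda>n. u (s2 n))"
      using ex[of s2] by auto
    have ge: "p x + e \<le> p x'"
      using hull_limits_functional_ge[OF x'(2) p] s2(2) by simp
    define w where "w = J x - J x'"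
    have lin: "bounded_linear (\<lambda>y. J y \<bullet> w)"
      by (rule bounded_linear_compose[OF bounded_linear_inner_left blinfun.bounded_linear_right])
    obtain l l' where l: "((\<lambda>t. (norm (J (u t) - J x))\<^sup>2) \<longlongrightarrow> l) at_top"
      "((\<lambda>t. (norm (J (u t) - J x'))\<^sup>2) \<longlongrightarrow> l') at_top"
      using dist x(1) x'(1) by blast
    define d where "d = (l' - l + (norm (J x))\<^sup>2 - (norm (J x'))\<^sup>2) / 2"
    have "((\<lambda>t. ((norm (J (u t) - J x'))\<^sup>2 - (norm (J (u t) - J x))\<^sup>2
        + (norm (J x))\<^sup>2 - (norm (J x'))\<^sup>2) / 2) \<longlongrightarrow> d) at_top"
      unfolding d_def by (intro tendsto_intros l) simp
    moreover have "((norm (J y - J x'))\<^sup>2 - (norm (J y - J x))\<^sup>2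
        + (norm (J x))\<^sup>2 - (norm (J x'))\<^sup>2) / 2 = J y \<bullet> w" for y
      by (simp add: w_def power2_norm_eq_inner inner_diff inner_commute)
    ultimately have d: "((\<lambda>t. J (u t) \<bullet> w) \<longlongrightarrow> d) at_top" by simp
    have "J x \<bullet> w = d"
      by (rule hull_limits_functional_eq[OF x(2) lin filterlim_compose[OF d s1]])
    moreover have "J x' \<bullet> w = d"
      by (rule hull_limits_functional_eq[OF x'(2) lin filterlim_compose[OF d s2lim]])
    ultimately have "w \<bullet> w = 0" by (simp add: w_def inner_diff_left)
    then have "J x = J x'" by (simp add: w_def)
    then have "x = x'" using inj by (simp add: inj_eq)
    with ge e show False by simp
  qed
  have "((\<lambda>t. p (u t)) \<longlongrightarrow> p x) at_top" for p :: "'v \<Rightarrow>\<^sub>L real"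
  proof (rule tendstoI)
    fix e :: real assume e: "e > 0"
    have "\<forall>\<^sub>F t in at_top. p (u t) < p x + e"
      by (rule ev[OF blinfun.bounded_linear_right e])
    moreover have "\<forall>\<^sub>F t in at_top. - p (u t) < - p x + e"
      by (rule ev[OF bounded_linear_minus[OF blinfun.bounded_linear_right] e])
    ultimately show "\<forall>\<^sub>F t in at_top. dist (p (u t)) (p x) < e"
      by eventually_elim (auto simp: dist_real_def abs_less_iff)
  qed
  then show ?thesis using x(1) by (auto simp: weakly_converges_def)
qed

section \<open>The potential\<close>

lemma convex_on_above_tangent:
  fixes F :: "'v::real_normed_vector \<Rightarrow> real"
  assumes F: "convex_on UNIV F" and d: "(F has_derivative F') (at x)"
  shows "F x + F' (y - x) \<le> F y"
proof -
  interpret F': bounded_linear F' using d by (rule has_derivative_bounded_linear)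
  define g where "g s = F (x + s *\<^sub>R (y - x))" for s :: real
  have "convex_on UNIV g"
  proof (rule convex_onI)
    fix t a b :: real assume t: "0 < t" "t < 1"
    have "g ((1 - t) *\<^sub>R a + t *\<^sub>R b) = F ((1 - t) *\<^sub>R (x + a *\<^sub>R (y - x)) + t *\<^sub>R (x + b *\<^sub>R (y - x)))"
      unfolding g_def by (rule arg_cong[of _ _ F]) (simp add: algebra_simps)
    also have "\<dots> \<le> (1 - t) * g a + t * g b"
      unfolding g_def using t by (intro convex_onD[OF F]) auto
    finally show "g ((1 - t) *\<^sub>R a + t *\<^sub>R b) \<le> (1 - t) * g a + t * g b" .
  qed simp
  moreover have "(g has_real_derivative F' (y - x)) (at 0)"
  proof -
    have "((\<lambda>s. x + s *\<^sub>R (y - x)) has_derivative (\<lambda>s. s *\<^sub>R (y - x))) (at 0)"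
      by (auto intro!: derivative_eq_intros)
    from has_derivative_compose[OF this, of F F'] d
    have "(g has_derivative (\<lambda>s. F' (s *\<^sub>R (y - x)))) (at 0)" by (simp add: g_def[abs_def])
    moreover have "(\<lambda>s. F' (s *\<^sub>R (y - x))) = (*) (F' (y - x))"
      by (simp add: F'.scaleR fun_eq_iff mult.commute)
    ultimately show ?thesis by (simp add: has_field_derivative_def)
  qed
  ultimately have "F' (y - x) * (1 - 0) \<le> g 1 - g 0"
    by (intro convex_on_imp_above_tangent[where A = UNIV]) auto
  then show ?thesis by (simp add: g_def)
qed

context
  fixes A :: "'v::{real_inner,banach} \<Rightarrow>\<^sub>L ('v \<Rightarrow>\<^sub>L real)" and f :: "'v \<Rightarrow> ('v \<Rightarrow>\<^sub>L real)" and F :: "'v \<Rightarrow> real"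
  assumes a_symmetric: "\<forall>x y. A x y = A y x"
    and F_convex: "convex_on UNIV F"
    and F_deriv: "\<forall>x. (F has_derivative blinfun_apply (f x)) (at x)"
begin

lemma potential_has_derivative: "(potential A F has_derivative blinfun_apply (A x + f x)) (at x)"
proof -
  have "((\<lambda>x. (1/2) * A x x + F x) has_derivative (\<lambda>h. (1/2) * (A x h + A h x) + f x h)) (at x)"
    using F_deriv by (auto intro!: derivative_eq_intros)
  moreover have "(\<lambda>h. (1/2) * (A x h + A h x) + f x h) = blinfun_apply (A x + f x)"
    using a_symmetric by (auto simp: fun_eq_iff blinfun.add_left)
  ultimately show ?thesis by (simp add: potential_def[abs_def])
qed

text \<open>
  Keeping the quadratic term makes this inequality do two jobs: at a minimiser it bounds
  \<open>A (y - x) (y - x)\<close> by the excess of the potential, and elsewhere it is the subgradient inequality.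
\<close>

lemma potential_above_tangent:
  "potential A F x + (A x + f x) (y - x) + (1/2) * A (y - x) (y - x) \<le> potential A F y"
proof -
  have "F x + f x (y - x) \<le> F y"
    using convex_on_above_tangent[OF F_convex] F_deriv by blast
  moreover have "A y y = A x x + 2 * A x (y - x) + A (y - x) (y - x)"
    using a_symmetric by (simp add: blinfun.diff_left blinfun.diff_right)
  ultimately show ?thesis by (simp add: potential_def blinfun.add_left add_divide_distrib)
qed

lemma derivative_zero_at_argmin:
  assumes "z \<in> argmin (potential A F)"
  shows "A z + f z = 0"
proof -
  have "blinfun_apply (A z + f z) = (\<lambda>h. 0)"
    by (rule has_derivative_local_min[OF potential_has_derivative])
      (use assms in \<open>auto simp: argmin_def is_arg_min_linorder\<close>)
  then show ?thesis by (intro blinfun_eqI) simp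
qed

lemma potential_continuous: "continuous_on S (potential A F)"
  by (meson continuous_at_imp_continuous_on has_derivative_continuous potential_has_derivative)

end

section \<open>Convergence of the trajectory\<close>

lemma INF_eq_argmin:
  fixes p :: "'a \<Rightarrow> real"
  assumes "z \<in> argmin p"
  shows "(INF x. p x) = p z"
  by (rule cInf_eq_minimum) (use assms in \<open>auto simp: argmin_def is_arg_min_linorder\<close>)

theorem theorem1p3:
  fixes J :: "'v::{real_inner,banach} \<Rightarrow>\<^sub>L 'h::{real_inner,banach}"
    and \<gamma> \<gamma>' :: "real \<Rightarrow> real"
    and A :: "'v \<Rightarrow>\<^sub>L ('v \<Rightarrow>\<^sub>L real)"
    and f :: "'v \<Rightarrow> ('v \<Rightarrow>\<^sub>L real)"
    and F :: "'v \<Rightarrow> real"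
    and u :: "real \<Rightarrow> 'v"
    and \<alpha> K t0 :: real
  assumes triple: "gelfand_triple J"
    and gamma_nonneg: "\<forall>t\<ge>0. 0 \<le> \<gamma> t"
    and gamma_decreasing: "antimono_on {0..} \<gamma>"
    and gamma_W11: "weak_deriv \<gamma> \<gamma>'"
    and a_symmetric: "\<forall>x y. blinfun_apply (blinfun_apply A x) y = blinfun_apply (blinfun_apply A y) x"
    and a_positive: "\<forall>x. 0 \<le> blinfun_apply (blinfun_apply A x) x"
    and a_coercive: "\<exists>lam\<ge>0. \<exists>\<mu>>0. \<forall>x. \<mu> * (norm x)\<^sup>2
           \<le> blinfun_apply (blinfun_apply A x) x + lam * (norm (blinfun_apply J x))\<^sup>2"
    and f_continuous: "continuous_on UNIV f"
    and F_convex: "convex_on UNIV F"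
    and F_deriv: "\<forall>x. (F has_derivative blinfun_apply (f x)) (at x)"
    and phi_bounded: "bdd_below (range (potential A F))"
    and phi_argmin: "argmin (potential A F) \<noteq> {}"
    and alpha: "0 \<le> \<alpha>" "\<alpha> < 1"
    and K_pos: "K > 0"
    and t0_nonneg: "t0 \<ge> 0"
    and gamma_lower: "\<forall>t\<ge>0. \<gamma> t \<ge> K / (1 + t) powr \<alpha>"
    and gamma_deriv: "AE t in lebesgue_on {t0..}. \<gamma>' t \<le> - \<alpha> * (\<gamma> t / (1 + t))"
    and solution: "is_solution J \<gamma> A f u"
  shows "(\<exists>u_inf \<in> argmin (potential A F). weakly_converges u u_inf at_top) \<and>
         (\<forall>\<beta><\<alpha>. (\<lambda>t. (1/2) * (norm (vector_derivative (\<lambda>s. blinfun_apply J (u s)) (at t)))\<^sup>2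
                      + potential A F (u t) - (INF x. potential A F x))
                \<in> o[at_top](\<lambda>t. 1 / t powr (1 + \<beta>)))"
proof -
  let ?\<phi> = "potential A F"
  define X where "X t = J (u t)" for t
  from solution obtain u' v w where u: "weak_deriv u u'" and X: "weak_deriv X v" and v: "weak_deriv v w"
    and eq: "AE t in lebesgue_on {0..}. pivot_embedding J (w t) + \<gamma> t *\<^sub>R pivot_embedding J (v t)
             + blinfun_apply A (u t) + f (u t) = 0"
    unfolding is_solution_def W11_loc_def X_def[abs_def] by blast
  note cu = weak_deriv_continuous[OF u] and cX = weak_deriv_continuous[OF X]
    and cv = weak_deriv_continuous[OF v] and cg = weak_deriv_continuous[OF gamma_W11]
  note tangent = potential_above_tangent[OF a_symmetric F_convex F_deriv]
  \<comment> \<open>By the equation, the derivative of the potential at \<open>u t\<close> is the element \<open>y t\<close> of \<open>H\<close>.\<close>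
  define y where "y t = - (w t + \<gamma> t *\<^sub>R v t)" for t
  have eqy: "AE t in lebesgue_on {0..}. \<forall>d. (A (u t) + f (u t)) d = y t \<bullet> J d"
    using eq
  proof eventually_elim
    case (elim t)
    show ?case
    proof
      fix d
      have "(pivot_embedding J (w t) + \<gamma> t *\<^sub>R pivot_embedding J (v t) + A (u t) + f (u t)) d = 0"
        using elim by simp
      then have "w t \<bullet> J d + \<gamma> t * (v t \<bullet> J d) + (A (u t) + f (u t)) d = 0"
        by (simp add: blinfun.add_left blinfun.scaleR_left pivot_embedding_apply)
      moreover have "y t \<bullet> J d = - (w t \<bullet> J d + \<gamma> t * (v t \<bullet> J d))"
        by (simp add: y_def inner_diff_left)
      ultimately show "(A (u t) + f (u t)) d = y t \<bullet> J d" by linarith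
    qed
  qed
  have phi_deriv: "weak_deriv (\<lambda>t. ?\<phi> (u t)) (\<lambda>t. y t \<bullet> v t)"
  proof (rule weak_deriv_subgradient[OF _ X cv, where N = "\<lambda>t. norm (w t) + \<gamma> t * norm (v t)"])
    show "continuous_on {0..} (\<lambda>t. ?\<phi> (u t))"
      by (rule continuous_on_compose2[OF potential_continuous[OF a_symmetric F_convex F_deriv] cu]) auto
    show "AE t in lebesgue_on {0..}. \<forall>s\<ge>0. y t \<bullet> (X s - X t) \<le> ?\<phi> (u s) - ?\<phi> (u t)"
      using eqy
    proof eventually_elim
      case (elim t)
      show ?case
      proof (intro allI impI)
        fix s :: real
        have "y t \<bullet> (X s - X t) = (A (u t) + f (u t)) (u s - u t)"
          using elim by (simp add: X_def blinfun.diff_right inner_diff_right)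
        also have "\<dots> \<le> ?\<phi> (u s) - ?\<phi> (u t)"
          using tangent[of "u t" "u s"] a_positive[rule_format, of "u s - u t"] by linarith
        finally show "y t \<bullet> (X s - X t) \<le> ?\<phi> (u s) - ?\<phi> (u t)" .
      qed
    qed
    fix T :: real assume T: "0 \<le> T"
    have cgT: "continuous_on {0..T} \<gamma>" and cvT: "continuous_on {0..T} v"
      by (auto intro: continuous_on_subset[OF cg] continuous_on_subset[OF cv])
    show "integrable (lebesgue_on {0..T}) (\<lambda>t. norm (w t) + \<gamma> t * norm (v t))"
      by (intro Bochner_Integration.integrable_add weak_deriv_norm_integrable[OF v]
          continuous_imp_integrable_real continuous_intros cgT cvT) simp
    fix Z :: "real \<Rightarrow> 'h" assume Z: "continuous_on {0..T} Z"
    have "integrable (lebesgue_on {0..T}) (\<lambda>t. w t \<bullet> Z t)"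
      by (rule integrable_bilinear_continuous[OF bounded_bilinear_inner
            weak_deriv_measurable[OF v order_refl] weak_deriv_norm_integrable[OF v order_refl] Z])
    moreover have "integrable (lebesgue_on {0..T}) (\<lambda>t. \<gamma> t * (v t \<bullet> Z t))"
      by (intro continuous_imp_integrable_real continuous_intros cgT cvT Z)
    ultimately have "integrable (lebesgue_on {0..T}) (\<lambda>t. - (w t \<bullet> Z t + \<gamma> t * (v t \<bullet> Z t)))"
      by simp
    then show "integrable (lebesgue_on {0..T}) (\<lambda>t. y t \<bullet> Z t)"
      by (simp add: y_def inner_diff_left)
  next
    fix t :: real assume "0 \<le> t"
    then show "norm (y t) \<le> norm (w t) + \<gamma> t * norm (v t)"
      unfolding y_def norm_minus_cancel
      using gamma_nonneg norm_triangle_ineq[of "w t" "\<gamma> t *\<^sub>R v t"] by simp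
  qed
  define E where "E z t = (1/2) * (v t \<bullet> v t) + (?\<phi> (u t) - ?\<phi> z)" for z t
  define h where "h z t = (1/2) * ((X t - J z) \<bullet> (X t - J z))" for z t
  have damped: "damped_inequality (E z) (h z) (\<lambda>t. v t \<bullet> (X t - J z)) (\<lambda>t. w t \<bullet> (X t - J z) + v t \<bullet> v t)
      (\<lambda>t. v t \<bullet> v t) \<gamma> \<gamma>' \<alpha> K t0" if z: "z \<in> argmin ?\<phi>" for z
  proof
    have z_min: "?\<phi> z \<le> ?\<phi> x" for x using z by (auto simp: argmin_def is_arg_min_linorder)
    note Xz = weak_deriv_diff_const[OF X, of "J z"]
    note inner = weak_deriv_bilinear[OF bounded_bilinear_inner]
    have "weak_deriv (E z) (\<lambda>t. (0 * (v t \<bullet> v t) + 1/2 * (w t \<bullet> v t + v t \<bullet> w t)) + y t \<bullet> v t)"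
      unfolding E_def
      by (intro weak_deriv_add weak_deriv_mult weak_deriv_const inner v weak_deriv_diff_const phi_deriv)
    moreover have "(0 * (v t \<bullet> v t) + 1/2 * (w t \<bullet> v t + v t \<bullet> w t)) + y t \<bullet> v t = - (\<gamma> t * (v t \<bullet> v t))" for t
      using inner_commute[of "v t" "w t"] by (simp add: y_def inner_diff_left)
    ultimately show "weak_deriv (E z) (\<lambda>t. - (\<gamma> t * (v t \<bullet> v t)))" by simp
    have "weak_deriv (h z) (\<lambda>t. 0 * ((X t - J z) \<bullet> (X t - J z)) + 1/2 * (v t \<bullet> (X t - J z) + (X t - J z) \<bullet> v t))"
      unfolding h_def by (intro weak_deriv_mult weak_deriv_const inner Xz)
    then show "weak_deriv (h z) (\<lambda>t. v t \<bullet> (X t - J z))" by (simp add: inner_commute)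
    show "weak_deriv (\<lambda>t. v t \<bullet> (X t - J z)) (\<lambda>t. w t \<bullet> (X t - J z) + v t \<bullet> v t)"
      by (rule inner[OF v Xz])
    show "AE t in lebesgue_on {0..}. w t \<bullet> (X t - J z) + v t \<bullet> v t + \<gamma> t * (v t \<bullet> (X t - J z))
        \<le> 3/2 * (v t \<bullet> v t) - E z t"
      using eqy
    proof eventually_elim
      case (elim t)
      have "?\<phi> (u t) + (A (u t) + f (u t)) (z - u t) \<le> ?\<phi> z"
        using tangent[of "u t" z] a_positive[rule_format, of "z - u t"] by linarith
      moreover have "(A (u t) + f (u t)) (z - u t) = w t \<bullet> (X t - J z) + \<gamma> t * (v t \<bullet> (X t - J z))"
      proof -
        have "(A (u t) + f (u t)) (z - u t) = y t \<bullet> J (z - u t)" using elim by blast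
        also have "\<dots> = w t \<bullet> (X t - J z) + \<gamma> t * (v t \<bullet> (X t - J z))"
          by (simp add: y_def X_def blinfun.diff_right inner_diff_right inner_diff_left algebra_simps)
        finally show ?thesis .
      qed
      ultimately show ?case by (simp add: E_def)
    qed
    show "AE t in lebesgue_on {t0..}. (1 + t) * \<gamma>' t \<le> - \<alpha> * \<gamma> t"
    proof -
      have "AE t in lebesgue_on {t0..}. t0 \<le> t" by (rule AE_I2) simp
      with gamma_deriv show ?thesis
        by eventually_elim (use t0_nonneg in \<open>simp add: field_simps\<close>)
    qed
    fix t :: real assume t: "0 \<le> t"
    show "K \<le> (1 + t) powr \<alpha> * \<gamma> t" using gamma_lower[rule_format, OF t] t by (simp add: field_simps)
    show "v t \<bullet> v t \<le> 2 * E z t" using z_min[of "u t"] by (simp add: E_def)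
    show "(v t \<bullet> (X t - J z))\<^sup>2 \<le> 2 * h z t * (v t \<bullet> v t)"
      using Cauchy_Schwarz_ineq[of "v t" "X t - J z"] by (simp add: h_def mult.commute)
  qed (auto simp: alpha K_pos t0_nonneg gamma_W11 h_def)
  obtain z where z: "z \<in> argmin ?\<phi>" using phi_argmin by blast
  interpret z: damped_inequality "E z" "h z" "\<lambda>t. v t \<bullet> (X t - J z)" "\<lambda>t. w t \<bullet> (X t - J z) + v t \<bullet> v t"
    "\<lambda>t. v t \<bullet> v t" \<gamma> \<gamma>' \<alpha> K t0 by (rule damped[OF z])
  have z_min: "?\<phi> z \<le> ?\<phi> x" for x using z by (auto simp: argmin_def is_arg_min_linorder)
  \<comment> \<open>The bound holds for some exponent strictly between \<open>q\<close> and \<open>1 + \<alpha>\<close>, which turns \<open>O\<close> into \<open>o\<close>.\<close>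
  have rate: "((\<lambda>t. E z t * t powr q) \<longlongrightarrow> 0) at_top" if q: "q < 1 + \<alpha>" for q
  proof -
    define r where "r = (max q 0 + (1 + \<alpha>)) / 2"
    have r: "0 < r" "r < 1 + \<alpha>" "q < r" using q alpha by (auto simp: r_def max_def)
    obtain T C where T: "0 \<le> T" "0 \<le> C" "\<And>t. T \<le> t \<Longrightarrow> E z t \<le> C * (1 + t) powr (- r)"
      using z.energy_and_distance_bounds[OF r(1,2)] by blast
    show ?thesis
    proof (rule Lim_null_comparison)
      have "((\<lambda>t::real. t powr (q - r)) \<longlongrightarrow> 0) at_top"
        using r by (intro tendsto_neg_powr filterlim_ident) simp
      from tendsto_mult_right_zero[OF this] show "((\<lambda>t. C * t powr (q - r)) \<longlongrightarrow> 0) at_top" .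
      show "\<forall>\<^sub>F t in at_top. norm (E z t * t powr q) \<le> C * t powr (q - r)"
        using eventually_ge_at_top[of T] eventually_gt_at_top[of 0]
      proof eventually_elim
        case (elim t)
        have "E z t \<le> C * (1 + t) powr (- r)" by (rule T) (use elim in simp)
        also have "\<dots> \<le> C * t powr (- r)"
          using elim T r by (intro mult_left_mono powr_mono2') auto
        finally have "E z t * t powr q \<le> C * t powr (- r) * t powr q"
          by (rule mult_right_mono) simp
        also have "\<dots> = C * t powr (q - r)" by (simp flip: powr_add)
        finally show ?case using z.E_nonneg[of t] elim by simp
      qed
    qed
  qed
  have Elim: "(E z \<longlongrightarrow> 0) at_top"
  proof (rule Lim_transform_eventually)
    show "((\<lambda>t. E z t * t powr 0) \<longlongrightarrow> 0) at_top" by (rule rate) (use alpha in simp)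
    show "\<forall>\<^sub>F t in at_top. E z t * t powr 0 = E z t"
      using eventually_gt_at_top[of 0] by eventually_elim simp
  qed
  have phi_le: "?\<phi> (u t) - ?\<phi> z \<le> E z t" for t by (simp add: E_def)
  have "\<exists>x\<in>argmin ?\<phi>. weakly_converges u x at_top"
  proof -
    obtain l where l: "(h z \<longlongrightarrow> l) at_top" using z.distance_convergent by blast
    obtain lam \<mu> where lam: "lam \<ge> 0" "\<mu> > 0" "\<And>x. \<mu> * (norm x)\<^sup>2 \<le> A x x + lam * (norm (J x))\<^sup>2"
      using a_coercive by blast
    \<comment> \<open>Coercivity bounds \<open>u\<close> in \<open>V\<close>: the form \<open>A\<close> is controlled by the energy and the \<open>H\<close>-norm by \<open>h z\<close>.\<close>
    define R where "R = sqrt ((2 + lam * (2 * (l + 1))) / \<mu>)"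
    have "\<forall>\<^sub>F t in at_top. E z t < 1 \<and> h z t < l + 1"
      using order_tendstoD(2)[OF Elim, of 1] order_tendstoD(2)[OF l, of "l + 1"] by (simp add: eventually_conj)
    then obtain T where T: "\<And>t. T \<le> t \<Longrightarrow> E z t < 1" "\<And>t. T \<le> t \<Longrightarrow> h z t < l + 1"
      unfolding eventually_at_top_linorder by blast
    have bdd: "norm (u t) \<le> norm z + R" if "T \<le> t" for t
    proof -
      have "A (u t - z) (u t - z) \<le> 2 * E z t"
        using tangent[of z "u t"] derivative_zero_at_argmin[OF a_symmetric F_convex F_deriv z] phi_le[of t]
        by simp
      moreover have "(norm (J (u t - z)))\<^sup>2 = 2 * h z t"
        by (simp add: h_def X_def blinfun.diff_right power2_norm_eq_inner)
      ultimately have "\<mu> * (norm (u t - z))\<^sup>2 \<le> 2 * E z t + lam * (2 * h z t)"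
        using lam(3)[of "u t - z"] by simp
      also have "\<dots> \<le> 2 + lam * (2 * (l + 1))"
        using T[OF that] lam(1) by (intro add_mono mult_left_mono) auto
      finally have "(norm (u t - z))\<^sup>2 \<le> (2 + lam * (2 * (l + 1))) / \<mu>"
        using lam(2) by (simp add: field_simps)
      then have "norm (u t - z) \<le> R" unfolding R_def by (rule real_le_rsqrt)
      then show ?thesis using norm_triangle_sub[of "u t" z] by linarith
    qed
    show ?thesis
    proof (rule weakly_converges_if_distances_converge[OF _ bdd])
      show "inj (blinfun_apply J)"
        using triple by (simp add: gelfand_triple_def dense_embedding_def)
      show "\<exists>l. ((\<lambda>t. (norm (J (u t) - J x))\<^sup>2) \<longlongrightarrow> l) at_top" if x: "x \<in> argmin ?\<phi>" for x
      proof -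
        interpret x: damped_inequality "E x" "h x" "\<lambda>t. v t \<bullet> (X t - J x)" "\<lambda>t. w t \<bullet> (X t - J x) + v t \<bullet> v t"
          "\<lambda>t. v t \<bullet> v t" \<gamma> \<gamma>' \<alpha> K t0 by (rule damped[OF x])
        obtain l where "(h x \<longlongrightarrow> l) at_top" using x.distance_convergent by blast
        then have "((\<lambda>t. 2 * h x t) \<longlongrightarrow> 2 * l) at_top" by (intro tendsto_intros)
        then show ?thesis by (auto simp: h_def X_def power2_norm_eq_inner)
      qed
      show "x \<in> argmin ?\<phi>" if s: "filterlim s at_top sequentially" and x: "x \<in> hull_limits (\<lambda>n. u (s n))" for s x
      proof -
        \<comment> \<open>The tangent half-space at \<open>x\<close> of level \<open>?\<phi> z + e\<close> contains \<open>u t\<close> for late \<open>t\<close>, hence the hull limit \<open>x\<close>.\<close>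
        have "?\<phi> x \<le> ?\<phi> z"
        proof (rule field_le_epsilon)
          fix e :: real assume "e > 0"
          then have "\<forall>\<^sub>F n in sequentially. E z (s n) < e"
            using order_tendstoD(2)[OF filterlim_compose[OF Elim s]] by blast
          then have "\<forall>\<^sub>F n in sequentially. ?\<phi> x - ?\<phi> z - e - (A x + f x) x \<le> - (A x + f x) (u (s n))"
          proof eventually_elim
            case (elim n)
            then show ?case
              using tangent[of x "u (s n)"] a_positive[rule_format, of "u (s n) - x"] phi_le[of "s n"]
                blinfun.diff_right[of "A x + f x" "u (s n)" x] by linarith
          qed
          from hull_limits_functional_ge[OF x bounded_linear_minus[OF blinfun.bounded_linear_right] this]
          show "?\<phi> x \<le> ?\<phi> z + e" by simp
        qed
        then show ?thesis using z_min by (auto simp: argmin_def is_arg_min_linorder intro: order_trans)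
      qed
    qed
  qed
  moreover have "(\<lambda>t. (1/2) * (norm (vector_derivative (\<lambda>s. J (u s)) (at t)))\<^sup>2 + ?\<phi> (u t) - (INF x. ?\<phi> x))
      \<in> o[at_top](\<lambda>t. 1 / t powr (1 + \<beta>))" if \<beta>: "\<beta> < \<alpha>" for \<beta>
  proof (rule smalloI_tendsto)
    show "\<forall>\<^sub>F t in at_top. 1 / t powr (1 + \<beta>) \<noteq> 0"
      using eventually_gt_at_top[of 0] by eventually_elim simp
    show "((\<lambda>t. ((1/2) * (norm (vector_derivative (\<lambda>s. J (u s)) (at t)))\<^sup>2 + ?\<phi> (u t) - (INF x. ?\<phi> x))
        / (1 / t powr (1 + \<beta>))) \<longlongrightarrow> 0) at_top"
    proof (rule Lim_transform_eventually)
      show "((\<lambda>t. E z t * t powr (1 + \<beta>)) \<longlongrightarrow> 0) at_top"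
        by (rule rate) (use \<beta> in simp)
      show "\<forall>\<^sub>F t in at_top. E z t * t powr (1 + \<beta>) =
        ((1/2) * (norm (vector_derivative (\<lambda>s. J (u s)) (at t)))\<^sup>2 + ?\<phi> (u t) - (INF x. ?\<phi> x))
        / (1 / t powr (1 + \<beta>))"
        using eventually_gt_at_top[of 0]
      proof eventually_elim
        case (elim t)
        have "(X has_vector_derivative v t) (at t within {0..})"
          by (rule weak_deriv_has_vector_derivative[OF X cv]) (use elim in simp)
        moreover have "at t within {0..} = at t"
          by (rule at_within_interior) (use elim in simp)
        ultimately have "vector_derivative (\<lambda>s. J (u s)) (at t) = v t"
          unfolding X_def[abs_def] by (simp add: vector_derivative_at)
        then show ?case
          by (simp add: E_def INF_eq_argmin[OF z] power2_norm_eq_inner algebra_simps)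
      qed
    qed
  qed
  ultimately show ?thesis by blast
qed

end
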